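(* Let $n\geq 2$ be an integer and let $\alpha>0$. Let $(c_j)=(c_1,c_n,c_{n+1},\dots)$ be a solution of the submonolayer deposition system $$ \dot c_1=\alpha-nc_1^n-c_1\sum_{j=n}^{\infty}c_j,\qquad \dot c_n=c_1^n-c_1c_n,\qquad \dot c_j=c_1c_{j-1}-c_1c_j\quad (j\geq n+1), $$ with initial data satisfying $c_j(0)=0$ for all $j\geq n$, and let $\widetilde c_j(\tau)$ denote the solution expressed in the new time $\tau=\int_0^t c_1(s)\,ds$, i.e. $\widetilde c_j(\tau)=c_j(t(\tau))$. Then for every fixed $\xi\in\mathbb{R}$ there is a constant $C$ such that, as $j,\tau\to+\infty$ with $\frac{j-\tau}{\sqrt{\tau}}=\xi$ (where $j$ is an integer), $$ \left|\frac{\sqrt{2\pi}}{\alpha}\left(\frac{\alpha}{n}\right)^{\frac1n}\tau^{\frac{n-1}{2n}}\,\widetilde c_j(\tau)-\Phi_{2,n}(\xi)\right|\leq C j^{-\frac12}\log j , $$ where $$ \Phi_{2,n}(\xi)=e^{-\xi^2/2}\int_0^{+\infty}\exp\left(-\xi w^n-\frac{w^{2n}}{2}\right)dw . $$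
   Context: The unknowns are $c_1$ and $c_j$, $j\geq n$, where $c_j(t)$ is the concentration of clusters of size $j$ at time $t\ge 0$ (there are no clusters of sizes $2,\dots,n-1$). A solution is a family of nonnegative differentiable functions on $[0,\infty)$, such that the series $\sum_{j=n}^\infty c_j(t)$ converges, satisfying the equations for $t\ge 0$; its initial condition is $(c_j(0))$. The new time is $\tau(t)=\int_0^t c_1(s)\,ds$, $t(\tau)$ denotes the inverse function of $t\mapsto\tau(t)$, and $\widetilde c_j(\tau):=c_j(t(\tau))$. The asymptotic inequality means that it holds for all sufficiently large $j$ and $\tau$ related by $(j-\tau)/\sqrt\tau=\xi$; $C$ does not depend on $j$ or $\tau$. *)

theory Defs
  imports "HOL-Analysis.Analysis"
begin

text \<open>
  A family \<open>(c\<^sub>1, c\<^sub>n, c\<^sub>n\<^sub>+\<^sub>1, \<dots>)\<close> is represented by a function \<open>c j t\<close> on all \<open>j :: nat\<close>; the values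
  for \<open>j = 0\<close> and \<open>2 \<le> j < n\<close> are irrelevant and left unconstrained. Derivatives are taken
  within \<open>[0,\<infinity>)\<close>, so they are one-sided at \<open>t = 0\<close>.
\<close>

definition deposition_solution :: "nat \<Rightarrow> real \<Rightarrow> (nat \<Rightarrow> real \<Rightarrow> real) \<Rightarrow> bool" where
  "deposition_solution n \<alpha> c \<longleftrightarrow>
     (\<forall>t\<ge>0.
        0 \<le> c 1 t \<and> (\<forall>j\<ge>n. 0 \<le> c j t) \<and>
        summable (\<lambda>i. c (n + i) t) \<and>
        (c 1 has_real_derivative
           \<alpha> - real n * c 1 t ^ n - c 1 t * (\<Sum>i. c (n + i) t)) (at t within {0..}) \<and>
        (c n has_real_derivative c 1 t ^ n - c 1 t * c n t) (at t within {0..}) \<and>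
        (\<forall>j\<ge>n + 1.
           (c j has_real_derivative c 1 t * c (j - 1) t - c 1 t * c j t) (at t within {0..})))"

definition new_time :: "(nat \<Rightarrow> real \<Rightarrow> real) \<Rightarrow> real \<Rightarrow> real" where
  "new_time c t = integral {0..t} (c 1)"

definition in_new_time :: "(nat \<Rightarrow> real \<Rightarrow> real) \<Rightarrow> nat \<Rightarrow> real \<Rightarrow> real" where
  "in_new_time c j \<tau> = c j (inv_into {0..} (new_time c) \<tau>)"

definition Phi2 :: "nat \<Rightarrow> real \<Rightarrow> real" where
  "Phi2 n \<xi> =
     exp (- \<xi>\<^sup>2 / 2) * integral {0..} (\<lambda>w. exp (- \<xi> * w ^ n - w ^ (2 * n) / 2))"

end

(*
  In the new time x, the sum S of all c_j and the single c_j form a chain of linear equations driven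
  by S', so that c_{n+m}(X) is the integral of S(x) * gamma_m'(X - x) over [0, X], where gamma_m is
  the density s^m exp(-s) / m!. A monotonicity argument in the original time gives
  S^n = n alpha^(n-1) x + O(log x), that is S = K x^(1/n) + E with E = O(x^(1/n-1) log x). This
  is the source of the logarithm. Bounding the error of S' alone would lose a power of X, since that
  error is integrable but not small; its integral vanishes because S(0) = 0.
  With r = sqrt X, rho = r^(1/n) and x = (rho w)^n, the main term becomes the integral of
  gamma_m(r^2 - r w^n) over w in [0, rho]; the density is compared with the Gaussian
  exp(-(xi + w^n)^2 / 2) through the differential equation of their ratio, Stirling's formula giving
  the value of the ratio at w = 0.
*)
theory Submission
  imports Defs "HOL-Real_Asymp.Real_Asymp"
begin

section \<open>Stirling's formula\<close>

text \<open>The estimate is relative: the main term has size \<open>\<rho> / r\<close>, and all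
  errors must be smaller by \<open>log r / r\<close>. Two effects give this. After the integration
  by parts, \<open>E\<close> meets not a density but the difference of two consecutive ones, smaller
  by an order \<open>1 / r\<close>. And passing from the bound on \<open>S ^ n\<close> to one on
  \<open>E\<close> costs a division by \<open>x powr ((n - 1) / n)\<close>, bad near 0; the Jacobian
  of \<open>x = (\<rho> * w) ^ n\<close> contains exactly this power, so \<open>E\<close> times the
  Jacobian is \<open>O (\<rho> * log r)\<close> on the whole interval. The range of \<open>w\<close>
  grows with \<open>r\<close>, so a pointwise Gaussian limit is not enough. The densities are
  compared with a relative error of polynomial growth on all of \<open>0 \<le> y \<le> r\<close>,
  \<open>y = w ^ n\<close>, and the Gaussian integrates the polynomial. This needs the peak value
  with a rate, hence Stirling's formula with an explicit error. The shift \<open>a\<close> in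
  \<open>m = r^2 + \<xi> * r - a\<close> is kept free because it takes the values \<open>n\<close>
  and \<open>n + 1\<close> for the two consecutive densities.\<close>

lemma stirling_aux_limit:
  fixes s :: "nat \<Rightarrow> real"
  defines "s \<equiv> \<lambda>m. ln (fact m) - (real m + 1/2) * ln (real m) + real m"
  shows "\<exists>L. s \<longlonglongrightarrow> L \<and> (\<forall>m\<ge>1. L \<le> s m \<and> s m \<le> L + 1 / real m)"
proof -
  \<comment> \<open>The increment is \<open>(m + 1/2) * ln (1 + 1/m) - 1\<close>. Convexity of
    \<open>1/x\<close> puts the logarithm between its midpoint and trapezoidal values; the first
    gives exactly 0, the second \<open>1 / (4 * m * (m + 1))\<close>. So \<open>s\<close> decreases
    while \<open>s m - 1 / m\<close> increases.\<close>
  have step: "0 \<le> s m - s (Suc m) \<and> s m - s (Suc m) \<le> 1 / real m - 1 / real (Suc m)"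
    if "m \<ge> 1" for m
  proof -
    have m: "real m > 0" using that by simp
    have f: "ln (fact (Suc m)) = ln (real m + 1) + ln (fact m :: real)"
      using m by (simp add: ln_mult add.commute)
    have d: "s m - s (Suc m) = (real m + 1/2) * (ln (real m + 1) - ln (real m)) - 1"
      unfolding s_def f by (simp add: algebra_simps)
    have "ln (real m + 1) - ln (real m) \<ge> 2 * 1 / (real m + real m + 1)"
      using ln_inverse_approx_ge[of "real m" "real m + 1"] m by (simp add: algebra_simps)
    then have "(real m + 1/2) * (ln (real m + 1) - ln (real m)) \<ge> (real m + 1/2) * (2 / (real m + real m + 1))"
      using m by (intro mult_left_mono) auto
    also have "(real m + 1/2) * (2 / (real m + real m + 1)) = 1"
      using m by (simp add: field_simps)
    finally have 1: "s m - s (Suc m) \<ge> 0" using d by simp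
    have "ln (real m + 1) - ln (real m) \<le> (inverse (real m) + inverse (real m + 1)) / 2"
      using ln_inverse_approx_le[of "real m" "1"] m by (simp add: add.commute)
    then have "(real m + 1/2) * (ln (real m + 1) - ln (real m)) \<le>
       (real m + 1/2) * ((inverse (real m) + inverse (real m + 1)) / 2)"
      using m by (intro mult_left_mono) auto
    also have "\<dots> \<le> 1 + (1 / real m - 1 / real (Suc m))"
      using m by (simp add: divide_simps add.commute) (simp add: algebra_simps)
    finally show ?thesis using 1 d by simp
  qed
  have dec: "decseq (\<lambda>k. s (Suc k))"
  proof (intro decseq_SucI)
    fix k show "s (Suc (Suc k)) \<le> s (Suc k)" using step[of "Suc k"] by simp
  qed
  have inc: "incseq (\<lambda>k. s (Suc k) - 1 / real (Suc k))"
  proof (intro incseq_SucI)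
    fix k show "s (Suc k) - 1 / real (Suc k) \<le> s (Suc (Suc k)) - 1 / real (Suc (Suc k))"
      using step[of "Suc k"] by simp
  qed
  have lb: "s (Suc k) \<ge> s 1 - 1" for k
  proof -
    have "s (Suc 0) - 1 \<le> s (Suc k) - 1 / real (Suc k)"
      using incseqD[OF inc, of 0 k] by simp
    also have "\<dots> \<le> s (Suc k)" by simp
    finally show ?thesis by simp
  qed
  obtain L where L: "(\<lambda>k. s (Suc k)) \<longlonglongrightarrow> L" "\<And>k. L \<le> s (Suc k)"
    using decseq_convergent[OF dec, of "s 1 - 1"] lb by blast
  have lim: "(\<lambda>k. s (Suc k) - 1 / real (Suc k)) \<longlonglongrightarrow> L - 0"
    by (intro tendsto_diff L(1)) real_asymp
  have "s (Suc k) - 1 / real (Suc k) \<le> L" for k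
    using incseq_le[OF inc] lim by simp
  then have bd: "L \<le> s (Suc k) \<and> s (Suc k) \<le> L + 1 / real (Suc k)" for k
    using L(2)[of k] by (metis diff_le_eq)
  have "L \<le> s m \<and> s m \<le> L + 1 / real m" if "m \<ge> 1" for m
    using bd[of "m - 1"] that by simp
  moreover have "s \<longlonglongrightarrow> L" using L(1) by (rule LIMSEQ_imp_Suc)
  ultimately show ?thesis by blast
qed

text \<open>In factorials, the logarithm of Wallis' product becomes a combination of
  \<open>ln (fact n)\<close> and \<open>ln (fact (2 * n))\<close>, which is what fixes the constant
  in Stirling's formula.\<close>

lemma wallis_prod_eq:
  "(\<Prod>k=1..n. (4 * real k ^ 2) / (4 * real k ^ 2 - 1))
     = 2 ^ (4 * n) * fact n ^ 4 / (fact (2 * n) ^ 2 * (2 * real n + 1))"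
proof (induction n)
  case (Suc n)
  have e: "fact (2 * Suc n) = (2 * real n + 2) * (2 * real n + 1) * fact (2 * n)"
    by (simp add: algebra_simps)
  have f: "fact (Suc n) = (real n + 1) * fact n" by simp
  have nz: "4 * (real n + 1) ^ 2 - 1 = (2 * real n + 1) * (2 * real n + 3)"
    by (simp add: power2_eq_square algebra_simps)
  have z: "(2 * real n + 1) \<noteq> 0" "2 * real n + 3 \<noteq> 0" "real n + 1 \<noteq> 0" "fact (2*n) \<noteq> (0::real)" by auto
  have "(\<Prod>k=1..Suc n. (4 * real k ^ 2) / (4 * real k ^ 2 - 1)) =
    2 ^ (4 * n) * fact n ^ 4 / (fact (2 * n) ^ 2 * (2 * real n + 1)) *
      (4 * (real n + 1) ^ 2 / ((2 * real n + 1) * (2 * real n + 3)))"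
    using Suc nz by (simp add: add.commute)
  also have "\<dots> = 2 ^ (4 * Suc n) * fact (Suc n) ^ 4 / (fact (2 * Suc n) ^ 2 * (2 * real (Suc n) + 1))"
  proof -
    have g: "2 * real n + 2 = 2 * (real n + 1)" "2 * real (Suc n) + 1 = 2 * real n + 3"
      "(2::real) ^ (4 * Suc n) = 16 * 2 ^ (4 * n)" by (simp_all add: power_add)
    show ?thesis unfolding e f g using z
      by (simp add: divide_simps power_mult_distrib) (simp add: power2_eq_square power4_eq_xxxx algebra_simps)
  qed
  finally show ?case .
qed simp

text \<open>Wallis' product identifies the limit \<open>L\<close>:
  \<open>4 * s n - 2 * s (2 * n)\<close> tends to \<open>2 * L\<close>, the leftover rational factor
  to \<open>1/4\<close>, the product to \<open>pi / 2\<close>. The rate comes from the monotonicity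
  of \<open>s\<close>, not from Wallis.\<close>

lemma ln_fact_stirling:
  assumes "m \<ge> 1"
  shows "\<bar>ln (fact m) - (ln (2 * pi) / 2 + (real m + 1/2) * ln (real m) - real m)\<bar> \<le> 1 / real m"
proof -
  define s where "s = (\<lambda>m. ln (fact m) - (real m + 1/2) * ln (real m) + real m)"
  obtain L where L: "s \<longlonglongrightarrow> L" "\<forall>m\<ge>1. L \<le> s m \<and> s m \<le> L + 1 / real m"
    using stirling_aux_limit unfolding s_def by blast
  define P where "P = (\<lambda>n. \<Prod>k=1..n. (4 * real k ^ 2) / (4 * real k ^ 2 - 1))"
  have Pln: "ln (P n) = 4 * s n - 2 * s (2 * n) + ln (real n / (2 * (2 * real n + 1)))" if "n \<ge> 1" for n
  proof -
    have "ln (P n) = 4 * real n * ln 2 + 4 * ln (fact n) - (2 * ln (fact (2 * n)) + ln (2 * real n + 1))"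
      unfolding P_def wallis_prod_eq by (simp add: ln_mult ln_div ln_realpow)
    moreover have "ln (real (2 * n)) = ln 2 + ln (real n)" using that by (simp add: ln_mult)
    moreover have "ln (real n / (2 * (2 * real n + 1))) = ln (real n) - (ln 2 + ln (2 * real n + 1))"
    proof -
      have "ln (2 * (2 * real n + 1)) = ln 2 + ln (2 * real n + 1)" by (rule ln_mult_pos) auto
      moreover have "real n \<noteq> 0" "2 * (2 * real n + 1) \<noteq> 0" using that by auto
      ultimately show ?thesis using ln_div[of "real n" "2 * (2 * real n + 1)"]
        by (simp only: if_True simp_thms)
    qed
    ultimately show ?thesis unfolding s_def by (simp add: algebra_simps)
  qed
  have lim1: "(\<lambda>n. ln (P n)) \<longlonglongrightarrow> ln (pi / 2)"
    unfolding P_def by (intro tendsto_ln wallis) auto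
  have lim2: "(\<lambda>n. 4 * s n - 2 * s (2 * n) + ln (real n / (2 * (2 * real n + 1)))) \<longlonglongrightarrow> 4 * L - 2 * L + ln (1/4)"
  proof (intro tendsto_add tendsto_diff tendsto_mult tendsto_const L(1))
    have "strict_mono (\<lambda>n::nat. 2 * n)" by (auto simp: strict_mono_def)
    then show "(\<lambda>n. s (2 * n)) \<longlonglongrightarrow> L"
      using LIMSEQ_subseq_LIMSEQ[OF L(1)] by (simp add: o_def)
    show "(\<lambda>n. ln (real n / (2 * (2 * real n + 1)))) \<longlonglongrightarrow> ln (1 / 4)"
      by (rule tendsto_ln) (real_asymp | simp)+
  qed
  have "\<forall>\<^sub>F n in sequentially. ln (P n) = 4 * s n - 2 * s (2 * n) + ln (real n / (2 * (2 * real n + 1)))"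
    using Pln by (auto simp: eventually_sequentially)
  then have "(\<lambda>n. 4 * s n - 2 * s (2 * n) + ln (real n / (2 * (2 * real n + 1)))) \<longlonglongrightarrow> ln (pi / 2)"
    using lim1 by (rule Lim_transform_eventually[rotated])
  then have "4 * L - 2 * L + ln (1/4) = ln (pi / 2)"
    using lim2 by (rule LIMSEQ_unique[symmetric])
  moreover have "ln (pi/2) = ln pi - ln 2" "ln (1/4) = - (2 * ln (2::real))" "ln (2*pi) = ln 2 + ln pi"
    using ln_realpow[of 2 2] by (simp_all add: ln_div ln_mult)
  ultimately have "L = ln (2 * pi) / 2" by simp
  then show ?thesis using L(2) assms unfolding s_def by (auto simp: abs_le_iff algebra_simps)
qed

lemma entropy_taylor_bigo:
  "(\<lambda>d::real. (1 + d) * ln (1 + d) - d - d\<^sup>2 / 2) \<in> O[at 0](\<lambda>d. d ^ 3)"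
proof -
  have "(\<lambda>d::real. (1 + d) * ln (1 + d) - d - d\<^sup>2 / 2) \<in> O[at_right 0](\<lambda>d. d ^ 3)" by real_asymp
  moreover have "(\<lambda>d::real. (1 + d) * ln (1 + d) - d - d\<^sup>2 / 2) \<in> O[at_left 0](\<lambda>d. d ^ 3)" by real_asymp
  ultimately show ?thesis by (simp add: at_eq_sup_left_right landau_o.big.sup)
qed

section \<open>Gaussian approximation of the gamma density\<close>

text \<open>As a function of \<open>m\<close> these are the Poisson weights of mean
  \<open>s\<close>, that is, the response of the chain to a unit impulse in its first
  equation.\<close>

definition gamma_pdf :: "nat \<Rightarrow> real \<Rightarrow> real" where
  "gamma_pdf m s = s ^ m * exp (- s) / fact m"

lemma gamma_pdf_nonneg: "s \<ge> 0 \<Longrightarrow> gamma_pdf m s \<ge> 0"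
  by (simp add: gamma_pdf_def)

text \<open>With \<open>m = r\<^sup>2 + \<xi> * r - a\<close>, the logarithmic derivative of the ratio of the two densities is a
  rational function that is \<open>O (1 / r)\<close> near the origin and negative beyond a fixed point, which
  makes the comparison uniform up to \<open>y = r\<close>.\<close>

lemma gamma_pdf_gauss_ratio_deriv:
  fixes \<xi> a r y :: real
  assumes "0 < r" "y < r" "real m = r\<^sup>2 + \<xi> * r - a" "m \<ge> 1"
  shows "((\<lambda>y. gamma_pdf m (r\<^sup>2 - r * y) * exp ((\<xi> + y)\<^sup>2 / 2)) has_real_derivative
           gamma_pdf m (r\<^sup>2 - r * y) * exp ((\<xi> + y)\<^sup>2 / 2) * ((a - y * (\<xi> + y)) / (r - y))) (at y)"
proof -
  define s where "s = r\<^sup>2 - r * y"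
  have s: "s = r * (r - y)" by (simp add: s_def power2_eq_square algebra_simps)
  then have s0: "s > 0" using assms by simp
  have pw: "s ^ m = s * s ^ (m - 1)" using assms(4) by (metis Suc_diff_1 less_le_trans power_Suc zero_less_one)
  have key: "real m - s = r * (\<xi> + y) - a" using assms(3) by (simp add: s_def algebra_simps)
  have "((\<lambda>y. gamma_pdf m (r\<^sup>2 - r * y) * exp ((\<xi> + y)\<^sup>2 / 2)) has_real_derivative
     (real m * s ^ (m - 1) * (- r) * exp (- s) + s ^ m * (exp (- s) * r)) / fact m * exp ((\<xi> + y)\<^sup>2 / 2)
       + exp ((\<xi> + y)\<^sup>2 / 2) * (\<xi> + y) * (s ^ m * exp (- s) / fact m)) (at y)"
    unfolding gamma_pdf_def s_def by (auto intro!: derivative_eq_intros simp: field_simps)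
  also have "(real m * s ^ (m - 1) * (- r) * exp (- s) + s ^ m * (exp (- s) * r)) / fact m * exp ((\<xi> + y)\<^sup>2 / 2)
       + exp ((\<xi> + y)\<^sup>2 / 2) * (\<xi> + y) * (s ^ m * exp (- s) / fact m)
     = s ^ (m - 1) * exp (- s) / fact m * exp ((\<xi> + y)\<^sup>2 / 2) * (- r * (real m - s) + s * (\<xi> + y))"
    unfolding pw by (simp add: field_simps)
  also have "- r * (real m - s) + s * (\<xi> + y) = r * (a - y * (\<xi> + y))"
    unfolding key unfolding s by (simp add: algebra_simps)
  also have "s ^ (m - 1) * exp (- s) / fact m * exp ((\<xi> + y)\<^sup>2 / 2) * (r * (a - y * (\<xi> + y)))
     = gamma_pdf m s * exp ((\<xi> + y)\<^sup>2 / 2) * ((a - y * (\<xi> + y)) / (r - y))"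
    unfolding gamma_pdf_def pw using assms by (simp add: s field_simps)
  finally show ?thesis unfolding s_def .
qed

text \<open>A Gronwall bound followed by the mean value theorem. The logarithmic derivative of
  \<open>q\<close> is at most \<open>D / r\<close> throughout, so \<open>q\<close> never exceeds
  \<open>q 0 * exp D\<close>; inserted into the derivative, this makes the change of
  \<open>q\<close> of order \<open>1 / r\<close>.\<close>

lemma gamma_pdf_gauss_ratio_bound:
  fixes \<xi> a r y :: real and m :: nat
  defines "q \<equiv> (\<lambda>y. gamma_pdf m (r\<^sup>2 - r * y) * exp ((\<xi> + y)\<^sup>2 / 2))"
    and "D \<equiv> 2 * (a + (\<bar>\<xi>\<bar> + a + 1) * \<bar>\<xi>\<bar>)"
  assumes r: "r > 0" "r \<ge> 2 * (\<bar>\<xi>\<bar> + a + 1)" and m: "real m = r\<^sup>2 + \<xi> * r - a" "m \<ge> 1"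
    and a: "a \<ge> 0" and y: "0 \<le> y" "y \<le> r"
  shows "\<bar>q y - q 0\<bar> \<le> q 0 * exp D * (2 / r) * (y * (1 + a + \<bar>\<xi>\<bar> * y + y\<^sup>2))"
proof -
  have D: "D \<ge> 0" using a by (simp add: D_def)
  have cont: "continuous_on A q" for A
    unfolding q_def gamma_pdf_def by (intro continuous_intros) auto
  have q0: "q z \<ge> 0" if "z \<le> r" for z
  proof -
    have "r\<^sup>2 - r * z = r * (r - z)" by (simp add: power2_eq_square algebra_simps)
    then show ?thesis unfolding q_def using that r by (auto intro!: mult_nonneg_nonneg gamma_pdf_nonneg)
  qed
  have der: "(q has_real_derivative q z * ((a - z * (\<xi> + z)) / (r - z))) (at z)" if "z < r" for z
    unfolding q_def using gamma_pdf_gauss_ratio_deriv[OF r(1) that m] by simp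
  \<comment> \<open>Beyond \<open>\<bar>\<xi>\<bar> + a + 1\<close> the numerator is nonpositive, so
    the pole at \<open>z = r\<close> does no harm. Before it the numerator is at most
    \<open>D / 2\<close> and the denominator at least \<open>r / 2\<close>; this is the origin of
    \<open>D\<close> and of the lower bound on \<open>r\<close>.\<close>
  have le: "(a - z * (\<xi> + z)) / (r - z) \<le> D / r" if "0 < z" "z < r" for z
  proof (cases "z \<ge> \<bar>\<xi>\<bar> + a + 1")
    case True
    have "1 \<le> z" using True a by linarith
    then have "a \<le> z * a + z" using a mult_right_mono[of 1 z a] by simp
    also have "\<dots> \<le> z * (\<xi> + z)"
    proof -
      have "a + 1 \<le> \<xi> + z" using True by linarith
      then have "z * (a + 1) \<le> z * (\<xi> + z)" using that by (intro mult_left_mono) auto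
      then show ?thesis by (simp add: algebra_simps)
    qed
    finally have "(a - z * (\<xi> + z)) / (r - z) \<le> 0" using that by (simp add: divide_nonpos_pos)
    also have "0 \<le> D / r" using D r by simp
    finally show ?thesis .
  next
    case False
    have "a - z * (\<xi> + z) \<le> a + z * \<bar>\<xi>\<bar>"
    proof -
      have "z * (- \<xi>) \<le> z * \<bar>\<xi>\<bar>" using that by (intro mult_left_mono) auto
      moreover have "z * z \<ge> 0" by simp
      moreover have "a - z * (\<xi> + z) = a + z * (- \<xi>) - z * z" by (simp add: algebra_simps)
      ultimately show ?thesis by linarith
    qed
    also have "\<dots> \<le> D / 2"
    proof -
      have "z * \<bar>\<xi>\<bar> \<le> (\<bar>\<xi>\<bar> + a + 1) * \<bar>\<xi>\<bar>" using False by (intro mult_right_mono) auto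
      moreover have "D / 2 = a + (\<bar>\<xi>\<bar> + a + 1) * \<bar>\<xi>\<bar>" by (simp only: D_def)  simp
      ultimately show ?thesis by linarith
    qed
    finally have 1: "a - z * (\<xi> + z) \<le> D / 2" .
    have "(a - z * (\<xi> + z)) / (r - z) \<le> (D / 2) / (r - z)" using 1 that by (intro divide_right_mono) auto
    also have "\<dots> \<le> (D / 2) / (r / 2)"
      using D that False r by (intro divide_left_mono) auto
    finally show ?thesis by simp
  qed
  have up: "q z \<le> q 0 * exp D" if z: "0 \<le> z" "z \<le> r" for z
  proof -
    have "q 0 * exp (- (D / r) * 0) \<ge> q z * exp (- (D / r) * z)"
    proof (rule DERIV_nonpos_imp_decreasing_open[OF z(1)])
      show "continuous_on {0..z} (\<lambda>x. q x * exp (- (D / r) * x))"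
        by (intro continuous_intros cont)
      fix x assume x: "0 < x" "x < z"
      have "((\<lambda>x. q x * exp (- (D / r) * x)) has_real_derivative
           q x * exp (- (D / r) * x) * ((a - x * (\<xi> + x)) / (r - x) - D / r)) (at x)"
        by (rule derivative_eq_intros der refl | use x z in \<open>simp add: algebra_simps\<close>)+
      moreover have "q x * exp (- (D / r) * x) * ((a - x * (\<xi> + x)) / (r - x) - D / r) \<le> 0"
        using le[of x] q0[of x] x z by (intro mult_nonneg_nonpos) auto
      ultimately show "\<exists>y. ((\<lambda>x. q x * exp (- (D / r) * x)) has_real_derivative y) (at x) \<and> y \<le> 0"
        by blast
    qed
    then have "q z * exp (- (D / r) * z) * exp ((D / r) * z) \<le> q 0 * exp ((D / r) * z)"
      by (intro mult_right_mono) auto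
    then have "q z \<le> q 0 * exp ((D / r) * z)" by (simp add: exp_minus field_simps flip: exp_add)
    also have "\<dots> \<le> q 0 * exp D"
    proof -
      have "D * z \<le> D * r" using z D by (intro mult_left_mono) auto
      then have "(D / r) * z \<le> D" using r by (simp add: field_simps)
      then show ?thesis using q0[of 0] r by (intro mult_left_mono) auto
    qed
    finally show ?thesis .
  qed
  define B where "B = q 0 * exp D"
  have B: "B \<ge> 0" "B \<ge> q 0" using q0[of 0] r D mult_left_mono[of 1 "exp D" "q 0"] by (auto simp: B_def)
  define h where "h = 1 + a + \<bar>\<xi>\<bar> * y + y\<^sup>2"
  have h: "h \<ge> 1" using a y by (simp add: h_def)
  show "\<bar>q y - q 0\<bar> \<le> q 0 * exp D * (2 / r) * (y * (1 + a + \<bar>\<xi>\<bar> * y + y\<^sup>2))"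
  proof (cases "y > r / 2")
    \<comment> \<open>Near the pole the slope is not controlled, but here
      \<open>2 / r * y > 1\<close>, so the claimed bound already exceeds the crude bound
      \<open>B\<close>.\<close>
    case True
    have "\<bar>q y - q 0\<bar> \<le> B" using up[OF y] B q0[OF y(2)] q0[of 0] r unfolding B_def by auto
    also have "B \<le> B * ((2 / r * y) * h)"
    proof -
      have "1 * 1 \<le> (2 / r * y) * h" using True r h by (intro mult_mono) (auto simp: field_simps)
      then have "B * 1 \<le> B * ((2 / r * y) * h)" using B(1) by (intro mult_left_mono) auto
      then show ?thesis by simp
    qed
    also have "\<dots> = B * (2 / r) * (y * h)" by simp
    finally show ?thesis unfolding B_def h_def .
  next
    case False
    have slope: "\<bar>q z * ((a - z * (\<xi> + z)) / (r - z))\<bar> \<le> B * (2 / r) * h" if z: "0 \<le> z" "z \<le> y" for z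
    proof -
      have "\<bar>z * (\<xi> + z)\<bar> \<le> \<bar>\<xi>\<bar> * y + y\<^sup>2"
      proof -
        have "\<bar>z * (\<xi> + z)\<bar> = z * \<bar>\<xi> + z\<bar>" using z by (simp add: abs_mult)
        also have "\<dots> \<le> y * (\<bar>\<xi>\<bar> + y)" using z by (intro mult_mono) auto
        finally show ?thesis by (simp add: power2_eq_square algebra_simps)
      qed
      then have 1: "\<bar>a - z * (\<xi> + z)\<bar> \<le> h" using a unfolding h_def by linarith
      have "\<bar>(a - z * (\<xi> + z)) / (r - z)\<bar> = \<bar>a - z * (\<xi> + z)\<bar> / (r - z)"
        using z False r by (simp add: abs_div)
      also have "\<dots> \<le> h / (r / 2)" using 1 z False r h by (intro frac_le) auto
      finally have 2: "\<bar>(a - z * (\<xi> + z)) / (r - z)\<bar> \<le> 2 / r * h" by (simp add: mult.commute)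
      have "\<bar>q z * ((a - z * (\<xi> + z)) / (r - z))\<bar> = q z * \<bar>(a - z * (\<xi> + z)) / (r - z)\<bar>"
        using q0[of z] z y by (simp add: abs_mult)
      also have "\<dots> \<le> B * (2 / r * h)"
        using 2 up[of z] z y q0[of z] B unfolding B_def[symmetric] by (intro mult_mono) auto
      finally show ?thesis by simp
    qed
    show ?thesis
    proof (cases "y = 0")
      case False
      then have "0 < y" using y by simp
      then obtain z where z: "0 < z" "z < y" "q y - q 0 = (y - 0) * (q z * ((a - z * (\<xi> + z)) / (r - z)))"
        using MVT2[of 0 y q "\<lambda>z. q z * ((a - z * (\<xi> + z)) / (r - z))"] der \<open>\<not> r / 2 < y\<close> r by fastforce
      have "\<bar>q y - q 0\<bar> = y * \<bar>q z * ((a - z * (\<xi> + z)) / (r - z))\<bar>"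
        unfolding z(3) using y by (simp add: abs_mult)
      also have "\<dots> \<le> y * (B * (2 / r) * h)" using slope[of z] z y by (intro mult_left_mono) auto
      also have "\<dots> = B * (2 / r) * (y * h)" by simp
      finally show ?thesis unfolding B_def h_def .
    qed simp
  qed
qed

text \<open>With \<open>d = \<xi> / r - a / r^2\<close> and \<open>m = r^2 * (1 + d)\<close>, the
  bracket times \<open>r^2\<close> is the exponent that Stirling's formula leaves in the density at
  \<open>s = r^2\<close>. Its quadratic term is \<open>\<xi>^2 / 2\<close> up to
  \<open>O (1 / r)\<close>, and the cubic remainder \<open>r^2 * d ^ 3\<close> has the same
  order.\<close>

lemma entropy_taylor_compose:
  fixes \<xi> a :: real
  shows "(\<lambda>r. \<xi>\<^sup>2 / 2 - r\<^sup>2 * ((1 + (\<xi> / r - a / r\<^sup>2)) * ln (1 + (\<xi> / r - a / r\<^sup>2)) - (\<xi> / r - a / r\<^sup>2))) \<in> O(\<lambda>r. 1 / r)"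
proof -
  obtain K where K: "K > 0" "\<forall>\<^sub>F d in at 0. \<bar>(1 + d) * ln (1 + d) - d - d\<^sup>2 / 2\<bar> \<le> K * \<bar>(d::real) ^ 3\<bar>"
    using entropy_taylor_bigo by (auto elim!: landau_o.bigE)
  then have "\<forall>\<^sub>F d in nhds 0. \<bar>(1 + d) * ln (1 + d) - d - d\<^sup>2 / 2\<bar> \<le> K * \<bar>(d::real) ^ 3\<bar>"
    by (auto simp: eventually_at_filter elim!: eventually_mono)
  moreover have "((\<lambda>r. \<xi> / r - a / r\<^sup>2) \<longlongrightarrow> 0) at_top" by real_asymp
  ultimately have ev: "\<forall>\<^sub>F r in at_top. \<bar>(1 + (\<xi> / r - a / r\<^sup>2)) * ln (1 + (\<xi> / r - a / r\<^sup>2)) - (\<xi> / r - a / r\<^sup>2) - (\<xi> / r - a / r\<^sup>2)\<^sup>2 / 2\<bar> \<le> K * \<bar>(\<xi> / r - a / r\<^sup>2) ^ 3\<bar>"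
    by (rule eventually_compose_filterlim)
  have 1: "(\<lambda>r. r\<^sup>2 * ((1 + (\<xi> / r - a / r\<^sup>2)) * ln (1 + (\<xi> / r - a / r\<^sup>2)) - (\<xi> / r - a / r\<^sup>2) - (\<xi> / r - a / r\<^sup>2)\<^sup>2 / 2)) \<in> O(\<lambda>r. r\<^sup>2 * (\<xi> / r - a / r\<^sup>2) ^ 3)"
    by (intro landau_o.big.mult landau_o.big_refl bigoI[where c = K]) (use ev in \<open>auto elim!: eventually_mono\<close>)
  have tend: "((\<lambda>r. c / r) \<longlongrightarrow> 0) at_top" for c :: real by real_asymp
  have 2: "(\<lambda>r. r\<^sup>2 * (\<xi> / r - a / r\<^sup>2) ^ 3) \<in> O(\<lambda>r. 1 / r)"
  proof (rule bigoI_tendsto)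
    have "((\<lambda>r. (\<xi> - a / r) ^ 3) \<longlongrightarrow> (\<xi> - 0) ^ 3) at_top" by (intro tendsto_intros tend)
    moreover have "\<forall>\<^sub>F r in at_top. (\<xi> - a / r) ^ 3 = r\<^sup>2 * (\<xi> / r - a / r\<^sup>2) ^ 3 / (1 / r)"
      using eventually_gt_at_top[of 0]
      by eventually_elim (simp add: field_simps power2_eq_square power3_eq_cube)
    ultimately show "((\<lambda>r. r\<^sup>2 * (\<xi> / r - a / r\<^sup>2) ^ 3 / (1 / r)) \<longlongrightarrow> (\<xi> - 0) ^ 3) at_top"
      by (rule Lim_transform_eventually)
    show "\<forall>\<^sub>F r::real in at_top. 1 / r \<noteq> 0" using eventually_gt_at_top[of 0] by eventually_elim simp
  qed
  have 3: "(\<lambda>r. \<xi>\<^sup>2 / 2 - r\<^sup>2 * ((\<xi> / r - a / r\<^sup>2)\<^sup>2 / 2)) \<in> O(\<lambda>r. 1 / r)"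
  proof (rule bigoI_tendsto)
    have "((\<lambda>r. \<xi> * a - a\<^sup>2 / 2 / r) \<longlongrightarrow> \<xi> * a - 0) at_top" by (intro tendsto_intros tend)
    moreover have "\<forall>\<^sub>F r in at_top. \<xi> * a - a\<^sup>2 / 2 / r = (\<xi>\<^sup>2 / 2 - r\<^sup>2 * ((\<xi> / r - a / r\<^sup>2)\<^sup>2 / 2)) / (1 / r)"
      using eventually_gt_at_top[of 0]
      by eventually_elim (simp add: field_simps power2_eq_square)
    ultimately show "((\<lambda>r. (\<xi>\<^sup>2 / 2 - r\<^sup>2 * ((\<xi> / r - a / r\<^sup>2)\<^sup>2 / 2)) / (1 / r)) \<longlongrightarrow> \<xi> * a - 0) at_top"
      by (rule Lim_transform_eventually)
    show "\<forall>\<^sub>F r::real in at_top. 1 / r \<noteq> 0" using eventually_gt_at_top[of 0] by eventually_elim simp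
  qed
  have "(\<lambda>r. (\<xi>\<^sup>2 / 2 - r\<^sup>2 * ((\<xi> / r - a / r\<^sup>2)\<^sup>2 / 2)) - r\<^sup>2 * ((1 + (\<xi> / r - a / r\<^sup>2)) * ln (1 + (\<xi> / r - a / r\<^sup>2)) - (\<xi> / r - a / r\<^sup>2) - (\<xi> / r - a / r\<^sup>2)\<^sup>2 / 2)) \<in> O(\<lambda>r. 1 / r)"
    by (rule sum_in_bigo(2)[OF 3 landau_o.big_trans[OF 1 2]])
  then show ?thesis by (simp add: algebra_simps)
qed

text \<open>In the logarithm three errors of order \<open>1 / r\<close> add up: the entropy term
  \<open>G r\<close>, the replacement of \<open>sqrt m\<close> by \<open>r\<close>, which costs
  \<open>ln (1 + d r) / 2\<close>, and the error of Stirling's formula.\<close>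

lemma gamma_pdf_peak:
  fixes \<xi> a :: real
  shows "\<exists>C R. R \<ge> 1 \<and> (\<forall>r m. r \<ge> R \<longrightarrow> real m = r\<^sup>2 + \<xi> * r - a \<longrightarrow>
           \<bar>sqrt (2 * pi) * r * gamma_pdf m (r\<^sup>2) * exp (\<xi>\<^sup>2 / 2) - 1\<bar> \<le> C / r)"
proof -
  define d where "d = (\<lambda>r. \<xi> / r - a / r\<^sup>2)"
  define G where "G = (\<lambda>r. \<xi>\<^sup>2 / 2 - r\<^sup>2 * ((1 + d r) * ln (1 + d r) - d r))"
  have d0: "(d \<longlongrightarrow> 0) at_top" unfolding d_def by real_asymp
  obtain K where K: "K > 0" "\<forall>\<^sub>F r in at_top. \<bar>G r\<bar> \<le> K * \<bar>1 / r\<bar>"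
    using entropy_taylor_compose[of \<xi> a] unfolding G_def d_def by (auto elim!: landau_o.bigE)
  have "(\<lambda>r. ln (1 + d r)) \<in> O(\<lambda>r. d r)"
  proof -
    have "(\<lambda>x::real. ln (1 + x)) \<in> O[at_right 0](\<lambda>x. x)" by real_asymp
    moreover have "(\<lambda>x::real. ln (1 + x)) \<in> O[at_left 0](\<lambda>x. x)" by real_asymp
    ultimately have "(\<lambda>x::real. ln (1 + x)) \<in> O[at 0](\<lambda>x. x)"
      by (simp add: at_eq_sup_left_right landau_o.big.sup)
    then obtain c where c: "\<forall>\<^sub>F x in at 0. \<bar>ln (1 + x)\<bar> \<le> c * \<bar>x::real\<bar>" by (auto elim!: landau_o.bigE)
    then have "\<forall>\<^sub>F x in nhds 0. \<bar>ln (1 + x)\<bar> \<le> c * \<bar>x::real\<bar>"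
      by (auto simp: eventually_at_filter elim!: eventually_mono)
    from eventually_compose_filterlim[OF this d0] show ?thesis by (intro bigoI[where c = c]) auto
  qed
  also have "d \<in> O(\<lambda>r. 1 / r)"
  proof (rule bigoI_tendsto)
    have tend: "((\<lambda>r. a / r) \<longlongrightarrow> 0) at_top" by real_asymp
    have "((\<lambda>r. \<xi> - a / r) \<longlongrightarrow> \<xi> - 0) at_top" by (intro tendsto_intros tend)
    moreover have "\<forall>\<^sub>F r in at_top. \<xi> - a / r = d r / (1 / r)"
      using eventually_gt_at_top[of 0]
      by eventually_elim (simp add: d_def field_simps power2_eq_square)
    ultimately show "((\<lambda>r. d r / (1 / r)) \<longlongrightarrow> \<xi> - 0) at_top" by (rule Lim_transform_eventually)
    show "\<forall>\<^sub>F r::real in at_top. 1 / r \<noteq> 0" using eventually_gt_at_top[of 0] by eventually_elim simp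
  qed
  finally obtain K' where K': "K' > 0" "\<forall>\<^sub>F r in at_top. \<bar>ln (1 + d r)\<bar> \<le> K' * \<bar>1 / r\<bar>"
    by (auto elim!: landau_o.bigE)
  have "\<forall>\<^sub>F r in at_top. \<bar>d r\<bar> < 1/2"
    using tendstoD[OF d0, of "1/2"] by (simp add: dist_real_def)
  \<comment> \<open>The bound 2 gives \<open>m \<ge> r\<close>, which turns the Stirling error
    \<open>1 / m\<close> into \<open>1 / r\<close>; the bound \<open>K + K' + 2\<close> gives
    \<open>\<bar>ln q\<bar> \<le> 1\<close>, so that \<open>exp\<close> can be linearised.\<close>
  moreover have "\<forall>\<^sub>F r in at_top. r \<ge> max 2 (K + K' + 2)" by (rule eventually_ge_at_top)
  ultimately have "\<forall>\<^sub>F r in at_top. \<bar>G r\<bar> \<le> K * \<bar>1 / r\<bar> \<and> \<bar>ln (1 + d r)\<bar> \<le> K' * \<bar>1 / r\<bar> \<and>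
      \<bar>d r\<bar> < 1/2 \<and> r \<ge> max 2 (K + K' + 2)"
    using K(2) K'(2) by eventually_elim auto
  then obtain R0 where R0: "\<And>r. r \<ge> R0 \<Longrightarrow> \<bar>G r\<bar> \<le> K * \<bar>1 / r\<bar> \<and> \<bar>ln (1 + d r)\<bar> \<le> K' * \<bar>1 / r\<bar> \<and>
      \<bar>d r\<bar> < 1/2 \<and> r \<ge> max 2 (K + K' + 2)"
    by (auto simp: eventually_at_top_linorder)
  have main: "\<bar>sqrt (2 * pi) * r * gamma_pdf m (r\<^sup>2) * exp (\<xi>\<^sup>2 / 2) - 1\<bar> \<le> (2 * (K + K' + 2)) / r"
    if r: "r \<ge> max 1 R0" and m: "real m = r\<^sup>2 + \<xi> * r - a" for r m
  proof -
    have b: "\<bar>G r\<bar> \<le> K / r" "\<bar>ln (1 + d r)\<bar> \<le> K' / r" "\<bar>d r\<bar> < 1/2" "r \<ge> 2" "r \<ge> K + K' + 2"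
      using R0[of r] r by auto
    have m': "real m = r\<^sup>2 * (1 + d r)" using m b(4) by (simp add: d_def distrib_left right_diff_distrib power2_eq_square)
    have d1: "1 + d r > 1/2" using b(3) by linarith
    have mr: "real m \<ge> r"
    proof -
      have "r \<le> r * (r * (1/2))" using b(4) by simp
      also have "\<dots> \<le> r\<^sup>2 * (1 + d r)" unfolding power2_eq_square mult.assoc[symmetric]
        using d1 b(4) by (intro mult_left_mono) auto
      finally show ?thesis using m' by simp
    qed
    then have m1: "m \<ge> 1" "real m > 0" using b(4) by (auto simp: Suc_le_eq)
    define q where "q = sqrt (2 * pi) * r * gamma_pdf m (r\<^sup>2) * exp (\<xi>\<^sup>2 / 2)"
    have q0: "q > 0" using b(4) by (simp add: q_def gamma_pdf_def)
    have lnm: "ln (real m) = 2 * ln r + ln (1 + d r)"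
      unfolding m' using b(4) d1 by (simp add: ln_mult ln_realpow)
    have "ln q = ln (2 * pi) / 2 + ln r + (real m * (2 * ln r) - r\<^sup>2 - ln (fact m)) + \<xi>\<^sup>2 / 2"
      unfolding q_def gamma_pdf_def using b(4)
      by (simp add: ln_mult ln_div ln_realpow ln_sqrt)
    moreover define e where "e = ln (fact m) - (ln (2 * pi) / 2 + (real m + 1/2) * ln (real m) - real m)"
    ultimately have "ln q = ln r + real m * (2 * ln r) - r\<^sup>2 + \<xi>\<^sup>2 / 2 - (real m + 1/2) * ln (real m) + real m - e"
      by simp
    also have "\<dots> = G r - ln (1 + d r) / 2 - e"
      unfolding lnm unfolding m' G_def by (simp add: algebra_simps)
    finally have lnq: "ln q = G r - ln (1 + d r) / 2 - e" .
    have e: "\<bar>e\<bar> \<le> 1 / r"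
    proof -
      have "\<bar>e\<bar> \<le> 1 / real m" using ln_fact_stirling[OF m1(1)] unfolding e_def .
      also have "\<dots> \<le> 1 / r" using mr b(4) by (intro divide_left_mono) auto
      finally show ?thesis .
    qed
    have "\<bar>ln q\<bar> \<le> K / r + K' / r + 2 / r"
      using lnq e b(1,2) by (simp add: abs_le_iff) 
    also have "\<dots> = (K + K' + 2) / r" by (simp add: add_divide_distrib)
    finally have l: "\<bar>ln q\<bar> \<le> (K + K' + 2) / r" .
    also have "\<dots> \<le> 1" using b(4,5) by simp
    finally have l1: "\<bar>ln q\<bar> \<le> 1" .
    have "\<bar>exp (ln q) - 1\<bar> \<le> 2 * \<bar>ln q\<bar>"
    proof (cases "ln q \<ge> 0")
      case True
      then have "exp (ln q) \<le> 1 + ln q + (ln q)\<^sup>2" using l1 by (intro exp_bound) auto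
      moreover have "(ln q)\<^sup>2 \<le> ln q" using True l1 by (simp add: power2_eq_square mult_left_le)
      ultimately show ?thesis using True by simp
    next
      case False
      then have "exp (ln q) \<le> 1" by simp
      moreover have "exp (ln q) \<ge> 1 + ln q" by (rule exp_ge_add_one_self)
      ultimately show ?thesis using False by linarith
    qed
    also have "\<dots> \<le> 2 * ((K + K' + 2) / r)" using l by linarith
    finally show ?thesis using q0 unfolding q_def[symmetric] by simp
  qed
  show ?thesis
    by (rule exI[of _ "2 * (K + K' + 2)"], rule exI[of _ "max 1 R0"]) (use main in auto)
qed

text \<open>The ratio of the densities is near 1 at \<open>y = 0\<close> by the peak estimate and
  moves little afterwards. The error stays relative to the Gaussian, so its growth like
  \<open>y ^ 3\<close> costs nothing under the integral.\<close>

lemma gamma_pdf_gauss: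
  fixes \<xi> a :: real
  assumes a: "a \<ge> 0"
  shows "\<exists>C R. C \<ge> 0 \<and> R \<ge> 1 \<and> (\<forall>r m y. r \<ge> R \<longrightarrow> real m = r\<^sup>2 + \<xi> * r - a \<longrightarrow> 0 \<le> y \<longrightarrow> y \<le> r \<longrightarrow>
           \<bar>sqrt (2 * pi) * r * gamma_pdf m (r\<^sup>2 - r * y) - exp (- (\<xi> + y)\<^sup>2 / 2)\<bar>
             \<le> C / r * (1 + y ^ 3) * exp (- (\<xi> + y)\<^sup>2 / 2))"
proof -
  obtain C0 R0 where R0: "R0 \<ge> 1" and C0: "\<And>r m. r \<ge> R0 \<Longrightarrow> real m = r\<^sup>2 + \<xi> * r - a \<Longrightarrow>
           \<bar>sqrt (2 * pi) * r * gamma_pdf m (r\<^sup>2) * exp (\<xi>\<^sup>2 / 2) - 1\<bar> \<le> C0 / r"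
    using gamma_pdf_peak[of \<xi> a] by blast
  define D where "D = 2 * (a + (\<bar>\<xi>\<bar> + a + 1) * \<bar>\<xi>\<bar>)"
  define R where "R = max R0 (max 1 (2 * (\<bar>\<xi>\<bar> + a + 1)))"
  \<comment> \<open>The first summand is the ratio bound with
    \<open>p * q 0 \<le> 1 + \<bar>C0\<bar>\<close>, the second the error at the peak.\<close>
  define C where "C = (1 + \<bar>C0\<bar>) * exp D * 2 * (1 + a + \<bar>\<xi>\<bar> + 1) + \<bar>C0\<bar>"
  have "\<bar>sqrt (2 * pi) * r * gamma_pdf m (r\<^sup>2 - r * y) - exp (- (\<xi> + y)\<^sup>2 / 2)\<bar>
             \<le> C / r * (1 + y ^ 3) * exp (- (\<xi> + y)\<^sup>2 / 2)"
    if r: "r \<ge> R" and m: "real m = r\<^sup>2 + \<xi> * r - a" and y: "0 \<le> y" "y \<le> r" for r m y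
  proof -
    have r': "r \<ge> R0" "r \<ge> 1" "r \<ge> 2 * (\<bar>\<xi>\<bar> + a + 1)" "r > 0" using r by (auto simp: R_def)
    have m1: "m \<ge> 1"
    proof -
      have "r * (\<bar>\<xi>\<bar> + a + 2) \<le> r * r" using r' a by (intro mult_left_mono) auto
      moreover have "r * \<bar>\<xi>\<bar> \<ge> - (r * \<xi>)" using r' by (simp add: abs_if)
      moreover have "r * a \<ge> a" using r' a by (simp add: mult_le_cancel_right1)
      ultimately have "real m \<ge> 1" using r' unfolding m power2_eq_square
        by (simp add: algebra_simps)
      then show ?thesis by simp
    qed
    define q where "q = (\<lambda>y. gamma_pdf m (r\<^sup>2 - r * y) * exp ((\<xi> + y)\<^sup>2 / 2))"
    define h where "h = y * (1 + a + \<bar>\<xi>\<bar> * y + y\<^sup>2)"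
    have b: "\<bar>q y - q 0\<bar> \<le> q 0 * exp D * (2 / r) * h"
      using gamma_pdf_gauss_ratio_bound[OF r'(4,3) m m1 a y] unfolding q_def D_def h_def .
    define p where "p = sqrt (2 * pi) * r"
    have p: "p > 0" using r' by (simp add: p_def)
    have "\<bar>p * q 0 - 1\<bar> \<le> C0 / r" using C0[OF r'(1) m] by (simp add: p_def q_def mult_ac)
    also have "\<dots> \<le> \<bar>C0\<bar> / r" using r' by (intro divide_right_mono) auto
    finally have b0: "\<bar>p * q 0 - 1\<bar> \<le> \<bar>C0\<bar> / r" .
    also have "\<dots> \<le> \<bar>C0\<bar>" using r' by (simp add: divide_le_eq mult_le_cancel_left1)
    finally have b1: "p * q 0 \<le> 1 + \<bar>C0\<bar>" by linarith
    have h: "h \<le> (1 + a + \<bar>\<xi>\<bar> + 1) * (1 + y ^ 3)" "h \<ge> 0"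
    proof -
      have y1: "y \<le> 1 + y ^ 3" "y\<^sup>2 \<le> 1 + y ^ 3"
      proof -
        consider "y \<le> 1" | "y \<ge> 1" by linarith
        then have "y \<le> 1 + y ^ 3 \<and> y\<^sup>2 \<le> 1 + y ^ 3"
        proof cases
          case 1
          then have "y\<^sup>2 \<le> 1" using y by (simp add: power_le_one)
          moreover have "y ^ 3 \<ge> 0" using y by simp
          ultimately show ?thesis using 1 by linarith
        next
          case 2
          then have "y ^ 1 \<le> y ^ 3" "y ^ 2 \<le> y ^ 3" by (intro power_increasing; simp)+
          then show ?thesis by simp
        qed
        then show "y \<le> 1 + y ^ 3" "y\<^sup>2 \<le> 1 + y ^ 3" by auto
      qed
      have "h = (1 + a) * y + \<bar>\<xi>\<bar> * y\<^sup>2 + y ^ 3"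
        by (simp add: h_def power2_eq_square power3_eq_cube algebra_simps)
      also have "\<dots> \<le> (1 + a) * (1 + y ^ 3) + \<bar>\<xi>\<bar> * (1 + y ^ 3) + 1 * (1 + y ^ 3)"
        using y1 a by (intro add_mono mult_left_mono) auto
      finally show "h \<le> (1 + a + \<bar>\<xi>\<bar> + 1) * (1 + y ^ 3)" by (simp add: algebra_simps)
      show "h \<ge> 0" unfolding h_def using y a by auto
    qed
    have "\<bar>p * q y - p * q 0\<bar> = p * \<bar>q y - q 0\<bar>" using p by (simp add: abs_mult flip: right_diff_distrib)
    also have "\<dots> \<le> p * (q 0 * exp D * (2 / r) * h)" using b p by (intro mult_left_mono) auto
    also have "\<dots> = (p * q 0) * (exp D * (2 / r) * h)" by (simp add: mult_ac)
    also have "\<dots> \<le> (1 + \<bar>C0\<bar>) * (exp D * (2 / r) * ((1 + a + \<bar>\<xi>\<bar> + 1) * (1 + y ^ 3)))"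
      using b1 h r' by (intro mult_mono mult_nonneg_nonneg) auto
    finally have 1: "\<bar>p * q y - p * q 0\<bar> \<le> (1 + \<bar>C0\<bar>) * exp D * 2 * (1 + a + \<bar>\<xi>\<bar> + 1) / r * (1 + y ^ 3)"
      by (simp only: mult_ac divide_inverse)
    have "\<bar>C0\<bar> / r * 1 \<le> \<bar>C0\<bar> / r * (1 + y ^ 3)" using r' y by (intro mult_left_mono) auto
    with b0 have 2: "\<bar>p * q 0 - 1\<bar> \<le> \<bar>C0\<bar> / r * (1 + y ^ 3)" by linarith
    have "\<bar>p * q y - 1\<bar> \<le> C / r * (1 + y ^ 3)"
      using 1 2 unfolding C_def add_divide_distrib distrib_right[of _ _ "1 + y ^ 3"] by linarith
    then have "\<bar>p * q y - 1\<bar> * exp (- (\<xi> + y)\<^sup>2 / 2) \<le> C / r * (1 + y ^ 3) * exp (- (\<xi> + y)\<^sup>2 / 2)"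
      by (intro mult_right_mono) auto
    moreover have "\<bar>p * q y - 1\<bar> * exp (- (\<xi> + y)\<^sup>2 / 2) = \<bar>(p * q y - 1) * exp (- (\<xi> + y)\<^sup>2 / 2)\<bar>"
      by (simp add: abs_mult)
    moreover have "(p * q y - 1) * exp (- (\<xi> + y)\<^sup>2 / 2) = p * gamma_pdf m (r\<^sup>2 - r * y) - exp (- (\<xi> + y)\<^sup>2 / 2)"
      by (simp add: q_def left_diff_distrib mult.assoc flip: exp_add)
    ultimately show ?thesis unfolding p_def by simp
  qed
  moreover have "C \<ge> 0" unfolding C_def using a by auto
  moreover have "R \<ge> 1" by (simp add: R_def)
  ultimately show ?thesis by blast
qed

section \<open>The chain of linear equations\<close>

text \<open>The densities obey the chain without its source; this is why sums of their products with
  the \<open>b i\<close> telescope.\<close>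

lemma gamma_pdf_deriv:
  "(gamma_pdf m has_real_derivative (if m = 0 then 0 else gamma_pdf (m - 1) s) - gamma_pdf m s) (at s)"
proof (cases m)
  case 0
  then show ?thesis unfolding gamma_pdf_def by (auto intro!: derivative_eq_intros)
next
  case (Suc p)
  have f: "(fact (Suc p) :: real) = (1 + real p) * fact p" by simp
  have "((\<lambda>s. s ^ Suc p) has_real_derivative real (Suc p) * s ^ p) (at s)"
    using DERIV_pow[of "Suc p" s UNIV] by simp
  moreover have "((\<lambda>s. exp (- s)) has_real_derivative - exp (- s)) (at s)"
    by (auto intro!: derivative_eq_intros)
  ultimately have "((\<lambda>s. s ^ Suc p * exp (- s) / fact (Suc p)) has_real_derivative
     (real (Suc p) * s ^ p * exp (- s) + - exp (- s) * s ^ Suc p) / fact (Suc p)) (at s)"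
    by (intro DERIV_cdivide DERIV_mult)
  also have "real (Suc p) * s ^ p * exp (- s) + - exp (- s) * s ^ Suc p = real (Suc p) * s ^ p * exp (- s) - s ^ Suc p * exp (- s)"
    by simp
  also have "(real (Suc p) * s ^ p * exp (- s) - s ^ Suc p * exp (- s)) / fact (Suc p) =
      s ^ p * exp (- s) / fact p - s ^ Suc p * exp (- s) / fact (Suc p)"
    unfolding diff_divide_distrib f by simp
  also have "\<dots> = (if m = 0 then 0 else gamma_pdf (m - 1) s) - gamma_pdf m s"
    using Suc by (simp add: gamma_pdf_def)
  finally show ?thesis
    using Suc by (simp only: gamma_pdf_def[abs_def])
qed

lemma gamma_pdf_zero: "gamma_pdf m 0 = (if m = 0 then 1 else 0)"
  by (simp add: gamma_pdf_def)

lemma continuous_on_gamma_pdf [continuous_intros]: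
  "continuous_on A f \<Longrightarrow> continuous_on A (\<lambda>x. gamma_pdf m (f x))"
  unfolding gamma_pdf_def by (intro continuous_intros) auto

text \<open>Derivatives are required only for \<open>x > 0\<close>: in the new time they arise
  through the factor \<open>1 / u\<close>, and \<open>u 0 = 0\<close> is allowed. No regularity of
  \<open>v\<close> is assumed, since it is only seen through its primitive \<open>T\<close>.\<close>

locale gamma_chain =
  fixes T v :: "real \<Rightarrow> real" and b :: "nat \<Rightarrow> real \<Rightarrow> real"
  assumes cont_T: "continuous_on {0..} T"
    and cont_b: "\<And>k. continuous_on {0..} (b k)"
    and T_0: "T 0 = 0" and b_0: "\<And>k. b k 0 = 0"
    and deriv_T: "\<And>x. x > 0 \<Longrightarrow> (T has_real_derivative v x) (at x)"
    and deriv_b0: "\<And>x. x > 0 \<Longrightarrow> (b 0 has_real_derivative v x - b 0 x) (at x)"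
    and deriv_b: "\<And>k x. x > 0 \<Longrightarrow> (b (Suc k) has_real_derivative b k x - b (Suc k) x) (at x)"
begin

text \<open>Along the characteristic \<open>x \<mapsto> X - x\<close> the chain telescopes; subtracting \<open>T \<cdot> gamma_pdf m\<close> removes the
  source \<open>v\<close>, so that only \<open>T\<close> itself enters.\<close>

definition primitive :: "nat \<Rightarrow> real \<Rightarrow> real \<Rightarrow> real" where
  "primitive m X x = (\<Sum>i\<le>m. b i x * gamma_pdf (m - i) (X - x)) - T x * gamma_pdf m (X - x)"

lemma primitive_deriv:
  assumes x: "x > 0"
  shows "(primitive (Suc p) X has_real_derivative
           T x * (gamma_pdf p (X - x) - gamma_pdf (Suc p) (X - x))) (at x)"
proof -
  define g where "g = (\<lambda>k. gamma_pdf k (X - x))"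
  define g' where "g' = (\<lambda>k. (if k = 0 then 0 else g (k - 1)) - g k)"
  define b' where "b' = (\<lambda>k. (if k = 0 then v x else b (k - 1) x) - b k x)"
  have dg: "((\<lambda>x. gamma_pdf k (X - x)) has_real_derivative - g' k) (at x)" for k
  proof -
    have "((\<lambda>x. X - x) has_real_derivative -1) (at x)" by (auto intro!: derivative_eq_intros)
    from DERIV_chain2[where f = "gamma_pdf k", OF gamma_pdf_deriv this] show ?thesis
      unfolding g'_def g_def by simp
  qed
  have db: "(b k has_real_derivative b' k) (at x)" for k
    using deriv_b0[OF x] deriv_b[OF x] by (cases k) (auto simp: b'_def)
  have D: "(primitive (Suc p) X has_real_derivative
    (\<Sum>i\<le>Suc p. b' i * g (Suc p - i) + b i x * (- g' (Suc p - i))) - (v x * g (Suc p) + T x * (- g' (Suc p)))) (at x)"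
    unfolding primitive_def g_def
    by (rule derivative_eq_intros dg db deriv_T[OF x] refl | simp add: g_def mult.commute)+
  \<comment> \<open>In the product rule the terms \<open>b i x * g (p - i)\<close> cancel directly
    and the terms \<open>b i x * g (Suc p - i)\<close> after an index shift; only the source in the
    equation for \<open>b 0\<close> is left.\<close>
  have "(\<Sum>i\<le>Suc p. b' i * g (Suc p - i) + b i x * (- g' (Suc p - i))) = v x * g (Suc p)"
  proof -
    have 1: "(\<Sum>i\<le>Suc p. b' i * g (Suc p - i)) = (v x - b 0 x) * g (Suc p) + (\<Sum>i\<le>p. b i x * g (p - i)) - (\<Sum>i\<le>p. b (Suc i) x * g (p - i))"
      unfolding sum.atMost_Suc_shift by (simp add: b'_def left_diff_distrib sum_subtractf)
    have 2: "(\<Sum>i\<le>Suc p. b i x * g' (Suc p - i)) = (\<Sum>i\<le>p. b i x * g (p - i)) - (\<Sum>i\<le>p. b i x * g (Suc p - i)) - b (Suc p) x * g 0"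
    proof -
      have "b i x * g' (Suc p - i) = b i x * g (p - i) - b i x * g (Suc p - i)" if "i \<le> p" for i
        using that by (auto simp: g'_def right_diff_distrib Suc_diff_le)
      then have "(\<Sum>i\<le>p. b i x * g' (Suc p - i)) = (\<Sum>i\<le>p. b i x * g (p - i) - b i x * g (Suc p - i))"
        by (intro sum.cong) auto
      then show ?thesis by (simp add: g'_def sum_subtractf)
    qed
    have "(\<Sum>i\<le>Suc p. b i x * g (Suc p - i)) = b 0 x * g (Suc p) + (\<Sum>i\<le>p. b (Suc i) x * g (p - i))"
      unfolding sum.atMost_Suc_shift by simp
    then have 3: "b 0 x * g (Suc p) + (\<Sum>i\<le>p. b (Suc i) x * g (p - i)) = (\<Sum>i\<le>p. b i x * g (Suc p - i)) + b (Suc p) x * g 0"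
      by simp
    have "(\<Sum>i\<le>Suc p. b' i * g (Suc p - i) + b i x * (- g' (Suc p - i))) =
      (\<Sum>i\<le>Suc p. b' i * g (Suc p - i)) - (\<Sum>i\<le>Suc p. b i x * g' (Suc p - i))"
      by (simp only: mult_minus_right sum.distrib sum_negf)
    then show ?thesis unfolding 1 2 using 3 by (simp add: algebra_simps)
  qed
  then have "(\<Sum>i\<le>Suc p. b' i * g (Suc p - i) + b i x * (- g' (Suc p - i))) - (v x * g (Suc p) + T x * (- g' (Suc p)))
     = T x * (g p - g (Suc p))"
    by (simp only: g'_def) (simp add: algebra_simps)
  from DERIV_cong[OF D this] show ?thesis unfolding g_def .
qed

text \<open>The term \<open>K * \<rho> * w\<close> is the leading behaviour of \<open>T\<close> at \<open>(\<rho> * w) ^ n\<close>; integrating it by parts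
  leaves the density itself, and in the variable \<open>w\<close> no singularity remains at the origin.\<close>

lemma has_integral_representation:
  fixes K \<rho> :: real
  assumes n: "n \<ge> 1" and rho: "\<rho> > 0"
  shows "((\<lambda>w. K * \<rho> * gamma_pdf (Suc p) (\<rho> ^ (2 * n) - (\<rho> * w) ^ n) +
            real n * \<rho> * (\<rho> * w) ^ (n - 1) * (T ((\<rho> * w) ^ n) - K * \<rho> * w) *
              (gamma_pdf p (\<rho> ^ (2 * n) - (\<rho> * w) ^ n) - gamma_pdf (Suc p) (\<rho> ^ (2 * n) - (\<rho> * w) ^ n)))
          has_integral b (Suc p) (\<rho> ^ (2 * n))) {0..\<rho>}"
proof -
  define X where "X = \<rho> ^ (2 * n)"
  define x where "x = (\<lambda>w. (\<rho> * w) ^ n)"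
  define F where "F = (\<lambda>w. primitive (Suc p) X (x w) + K * \<rho> * w * gamma_pdf (Suc p) (X - x w))"
  have X: "X = x \<rho>" by (simp add: X_def x_def power_mult power2_eq_square)
  have cx: "continuous_on A x" for A unfolding x_def by (intro continuous_intros)
  have xpos: "x w \<ge> 0" if "w \<ge> 0" for w using that rho by (simp add: x_def)
  have cb: "continuous_on {0..\<rho>} (\<lambda>w. b k (x w))" for k
    by (rule continuous_on_compose2[where g = "b k" and f = x, OF cont_b cx]) (simp add: image_subset_iff xpos)
  have cT: "continuous_on {0..\<rho>} (\<lambda>w. T (x w))"
    by (rule continuous_on_compose2[where g = T and f = x, OF cont_T cx]) (simp add: image_subset_iff xpos)
  have "continuous_on {0..\<rho>} F"
    unfolding F_def primitive_def by (intro continuous_intros cx cb cT)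
  moreover have "(F has_real_derivative K * \<rho> * gamma_pdf (Suc p) (X - x w) +
      real n * \<rho> * (\<rho> * w) ^ (n - 1) * (T (x w) - K * \<rho> * w) *
        (gamma_pdf p (X - x w) - gamma_pdf (Suc p) (X - x w))) (at w)" if w: "0 < w" for w
  proof -
    have x0: "x w > 0" using w rho by (simp add: x_def)
    have dx: "(x has_real_derivative real n * \<rho> * (\<rho> * w) ^ (n - 1)) (at w)"
      unfolding x_def by (auto intro!: derivative_eq_intros)
    have 1: "((\<lambda>w. primitive (Suc p) X (x w)) has_real_derivative
      T (x w) * (gamma_pdf p (X - x w) - gamma_pdf (Suc p) (X - x w)) * (real n * \<rho> * (\<rho> * w) ^ (n - 1))) (at w)"
      by (rule DERIV_chain2[OF primitive_deriv[OF x0] dx])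
    have 2: "((\<lambda>w. gamma_pdf (Suc p) (X - x w)) has_real_derivative
      (gamma_pdf p (X - x w) - gamma_pdf (Suc p) (X - x w)) * (0 - real n * \<rho> * (\<rho> * w) ^ (n - 1))) (at w)"
      using DERIV_chain2[where f = "gamma_pdf (Suc p)" and g = "\<lambda>w. X - x w",
          OF gamma_pdf_deriv DERIV_diff[OF DERIV_const dx]] by simp
    show ?thesis unfolding F_def
      by (rule DERIV_cong[OF DERIV_add[OF 1 DERIV_mult[OF DERIV_cmult[OF DERIV_ident] 2]]])
         (simp add: algebra_simps)
  qed
  \<comment> \<open>The interior form of the fundamental theorem is needed: at \<open>w = 0\<close>
    only continuity is known.\<close>
  ultimately have "((\<lambda>w. K * \<rho> * gamma_pdf (Suc p) (X - x w) +
      real n * \<rho> * (\<rho> * w) ^ (n - 1) * (T (x w) - K * \<rho> * w) *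
        (gamma_pdf p (X - x w) - gamma_pdf (Suc p) (X - x w))) has_integral (F \<rho> - F 0)) {0..\<rho>}"
    using rho by (intro fundamental_theorem_of_calculus_interior)
      (auto simp: has_real_derivative_iff_has_vector_derivative)
  moreover have "F 0 = 0"
  proof -
    have "x 0 = 0" using n by (simp add: x_def)
    then show ?thesis by (simp add: F_def primitive_def T_0 b_0)
  qed
  \<comment> \<open>At the upper end every density has argument 0, where only index 0 survives; the
    terms with \<open>T\<close> and \<open>K\<close> carry the index \<open>Suc p\<close> and drop
    out.\<close>
  moreover have "F \<rho> = b (Suc p) X"
  proof -
    have "(\<Sum>i\<le>Suc p. b i X * gamma_pdf (Suc p - i) 0) = (\<Sum>i\<le>Suc p. if i = Suc p then b i X else 0)"
      by (intro sum.cong) (auto simp: gamma_pdf_zero)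
    then show ?thesis unfolding F_def primitive_def X[symmetric] by (simp add: gamma_pdf_zero)
  qed
  ultimately show ?thesis unfolding X_def x_def by simp
qed

end

section \<open>Integrability of the polynomially weighted Gaussian\<close>

lemma polynomial_gauss_integrable:
  fixes \<xi> :: real
  assumes n: "n \<ge> 1"
  shows "(\<lambda>w. (1 + (w ^ n) ^ 3) * (1 + w ^ n) * exp (- (\<xi> + w ^ n)\<^sup>2 / 2)) integrable_on {0..}"
    and "(\<lambda>w. exp (- (\<xi> + w ^ n)\<^sup>2 / 2)) integrable_on {0..}"
proof -
  \<comment> \<open>28 is \<open>1 + 27\<close>, from \<open>y ^ 3 \<le> 27 * exp y\<close>;
    \<open>9/2 - 3 * \<xi>\<close> comes from completing the square in
    \<open>2 * y - (\<xi> + y)^2 / 2 \<le> 9/2 - 3 * \<xi> - y\<close>; \<open>exp 1\<close> pays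
    for \<open>w - 1 \<le> w ^ n\<close>.\<close>
  define M where "M = 28 * exp (9/2 - 3 * \<xi>) * exp 1"
  have b: "(1 + y ^ 3) * (1 + y) * exp (- (\<xi> + y)\<^sup>2 / 2) \<le> 28 * exp (9/2 - 3 * \<xi>) * exp (- y)" if "y \<ge> 0" for y
  proof -
    have "y / 3 \<le> exp (y / 3)" using exp_ge_add_one_self[of "y / 3"] by linarith
    then have "(y / 3) ^ 3 \<le> exp (y / 3) ^ 3" using that by (intro power_mono) auto
    then have "y ^ 3 \<le> 27 * exp y" by (simp add: power_divide flip: exp_of_nat_mult)
    moreover have "exp y \<ge> 1" using that by simp
    ultimately have "1 + y ^ 3 \<le> 28 * exp y" by linarith
    then have "(1 + y ^ 3) * (1 + y) * exp (- (\<xi> + y)\<^sup>2 / 2) \<le> 28 * exp y * exp y * exp (- (\<xi> + y)\<^sup>2 / 2)"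
      using that by (intro mult_mono) auto
    also have "\<dots> = 28 * exp (2 * y - (\<xi> + y)\<^sup>2 / 2)" by (simp flip: exp_add)
    also have "\<dots> \<le> 28 * exp ((9/2 - 3 * \<xi>) - y)"
    proof -
      have "(9/2 - 3 * \<xi> - y) - (2 * y - (\<xi> + y)\<^sup>2 / 2) = (\<xi> + y - 3)\<^sup>2 / 2"
        by (simp add: power2_eq_square field_simps)
      moreover have "(\<xi> + y - 3)\<^sup>2 / 2 \<ge> 0" by simp
      ultimately have "2 * y - (\<xi> + y)\<^sup>2 / 2 \<le> 9/2 - 3 * \<xi> - y" by (metis diff_ge_0_iff_ge)
      then show ?thesis by simp
    qed
    also have "\<dots> = 28 * exp (9/2 - 3 * \<xi>) * exp (- y)" by (simp add: mult.assoc flip: exp_add)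
    finally show ?thesis .
  qed
  have dom: "(1 + (w ^ n) ^ 3) * (1 + w ^ n) * exp (- (\<xi> + w ^ n)\<^sup>2 / 2) \<le> M * exp (- 1 * w)" if "w \<ge> 0" for w
  proof -
    have "w - 1 \<le> w ^ n"
    proof (cases "w \<le> 1")
      case True
      have "w ^ n \<ge> 0" using that by simp
      then show ?thesis using True by linarith
    next
      case False
      then have "w ^ 1 \<le> w ^ n" using n by (intro power_increasing) auto
      then show ?thesis by simp
    qed
    then have "exp (- (w ^ n)) \<le> exp 1 * exp (- w)" by (simp flip: exp_add)
    then have "28 * exp (9/2 - 3 * \<xi>) * exp (- (w ^ n)) \<le> 28 * exp (9/2 - 3 * \<xi>) * (exp 1 * exp (- w))"
      by (intro mult_left_mono) auto
    moreover have "28 * exp (9/2 - 3 * \<xi>) * (exp 1 * exp (- w)) = M * exp (- 1 * w)" by (simp add: M_def)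
    moreover have "w ^ n \<ge> 0" using that by simp
    ultimately show ?thesis using b[of "w ^ n"] by linarith
  qed
  have int: "(\<lambda>w. M * exp (- 1 * w)) integrable_on {0..}"
    by (rule integrable_on_mult_right[OF integrable_on_exp_minus_to_infinity]) simp
  show "(\<lambda>w. (1 + (w ^ n) ^ 3) * (1 + w ^ n) * exp (- (\<xi> + w ^ n)\<^sup>2 / 2)) integrable_on {0..}"
  proof (rule measurable_bounded_by_integrable_imp_integrable[OF _ int])
    show "(\<lambda>w. (1 + (w ^ n) ^ 3) * (1 + w ^ n) * exp (- (\<xi> + w ^ n)\<^sup>2 / 2)) \<in> borel_measurable (lebesgue_on {0..})"
      by (intro continuous_imp_measurable_on_sets_lebesgue continuous_intros) auto
  qed (use dom in auto)
  show "(\<lambda>w. exp (- (\<xi> + w ^ n)\<^sup>2 / 2)) integrable_on {0..}"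
  proof (rule measurable_bounded_by_integrable_imp_integrable[OF _ int])
    show "(\<lambda>w. exp (- (\<xi> + w ^ n)\<^sup>2 / 2)) \<in> borel_measurable (lebesgue_on {0..})"
      by (intro continuous_imp_measurable_on_sets_lebesgue continuous_intros) auto
    fix w :: real assume w: "w \<in> {0..}"
    have "1 * 1 \<le> (1 + (w ^ n) ^ 3) * (1 + w ^ n)" using w by (intro mult_mono) auto
    then have "1 * exp (- (\<xi> + w ^ n)\<^sup>2 / 2) \<le> (1 + (w ^ n) ^ 3) * (1 + w ^ n) * exp (- (\<xi> + w ^ n)\<^sup>2 / 2)"
      by (intro mult_right_mono) auto
    from order_trans[OF this dom[of w]] w show "norm (exp (- (\<xi> + w ^ n)\<^sup>2 / 2)) \<le> M * exp (- 1 * w)" by simp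
  qed auto
qed

section \<open>Growth of the total cluster number\<close>

lemma has_real_derivative_half_line_at:
  fixes f :: "real \<Rightarrow> real"
  assumes "(f has_real_derivative D) (at t within {0..})" "t > 0"
  shows "(f has_real_derivative D) (at t)"
proof -
  have "at t within {0..} = at t"
    using assms(2) by (intro at_within_interior) (auto simp: interior_Ici[of "-1"])
  then show ?thesis using assms(1) by simp
qed

lemma has_real_derivative_half_line_continuous:
  fixes f :: "real \<Rightarrow> real"
  assumes "\<And>t. t \<ge> 0 \<Longrightarrow> (f has_real_derivative f' t) (at t within {0..})"
  shows "continuous_on {0..} f"
  using assms by (auto simp: continuous_on_eq_continuous_within intro: DERIV_continuous)

lemma half_line_nondecreasing:
  fixes f :: "real \<Rightarrow> real"
  assumes d: "\<And>x. x \<ge> 0 \<Longrightarrow> (f has_real_derivative f' x) (at x within {0..})"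
    and nn: "\<And>x. s < x \<Longrightarrow> f' x \<ge> 0" and st: "0 \<le> s" "s \<le> t"
  shows "f s \<le> f t"
proof (rule DERIV_nonneg_imp_increasing_open[OF st(2)])
  show "continuous_on {s..t} f"
    using has_real_derivative_half_line_continuous[OF d] st by (auto intro: continuous_on_subset)
  fix x assume "s < x" "x < t"
  then show "\<exists>y. (f has_real_derivative y) (at x) \<and> 0 \<le> y"
    using has_real_derivative_half_line_at[OF d, of x] nn[of x] st by auto
qed

lemma half_line_increasing:
  fixes f :: "real \<Rightarrow> real"
  assumes d: "\<And>x. x \<ge> 0 \<Longrightarrow> (f has_real_derivative f' x) (at x within {0..})"
    and nn: "\<And>x. s < x \<Longrightarrow> f' x > 0" and st: "0 \<le> s" "s < t"
  shows "f s < f t"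
proof (rule DERIV_pos_imp_increasing_open[OF st(2)])
  show "continuous_on {s..t} f"
    using has_real_derivative_half_line_continuous[OF d] st by (auto intro: continuous_on_subset)
  fix x assume "s < x" "x < t"
  then show "\<exists>y. (f has_real_derivative y) (at x) \<and> 0 < y"
    using has_real_derivative_half_line_at[OF d, of x] nn[of x] st by auto
qed

text \<open>With \<open>M\<close> the claimed bound, \<open>K - L * M \<le> 0\<close>, so
  \<open>(f x - M) * exp (L * x)\<close> does not increase, and it starts nonpositive.\<close>

lemma linear_decay_bound:
  fixes f :: "real \<Rightarrow> real"
  assumes d: "\<And>x. x \<ge> 0 \<Longrightarrow> (f has_real_derivative f' x) (at x within {0..})"
    and le: "\<And>x. s < x \<Longrightarrow> f' x \<le> K - L * f x" and L: "L > 0" and st: "0 \<le> s" "s \<le> t"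
  shows "f t \<le> max (f s) (K / L)"
proof -
  define M where "M = max (f s) (K / L)"
  have "- (f s - M) * exp (L * s) \<le> - (f t - M) * exp (L * t)"
  proof (rule half_line_nondecreasing[OF _ _ st])
    fix x :: real assume "x \<ge> 0"
    show "((\<lambda>x. - (f x - M) * exp (L * x)) has_real_derivative
       exp (L * x) * (L * M - L * f x - f' x)) (at x within {0..})"
      by (rule derivative_eq_intros d[OF \<open>x \<ge> 0\<close>] refl | simp add: algebra_simps)+
  next
    fix x assume "s < x"
    have "K / L \<le> M" by (simp add: M_def)
    then have "K \<le> L * M" using L by (simp add: field_simps)
    then show "exp (L * x) * (L * M - L * f x - f' x) \<ge> 0"
      using le[OF \<open>s < x\<close>] by (intro mult_nonneg_nonneg) auto
  qed
  moreover have "- (f s - M) * exp (L * s) \<ge> 0" unfolding M_def by (intro mult_nonneg_nonneg) auto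
  ultimately have "- (f t - M) * exp (L * t) \<ge> 0" by linarith
  then show ?thesis unfolding M_def[symmetric] by (simp add: zero_le_mult_iff mult_le_0_iff)
qed

lemma integral_half_line_deriv:
  fixes g :: "real \<Rightarrow> real"
  assumes g: "continuous_on {0..} g" and t: "t \<ge> 0"
  shows "((\<lambda>x. integral {0..x} g) has_real_derivative g t) (at t within {0..})"
proof -
  have "((\<lambda>x. integral {0..x} g) has_real_derivative g t) (at t within {0..t+1})"
    using t by (intro integral_has_real_derivative) (auto intro: continuous_on_subset[OF g])
  moreover have "at t within {0..t+1} = at t within {0..}"
    by (rule at_within_nhd[where S = "{..<t+1}"]) auto
  ultimately show ?thesis by simp
qed

text \<open>Both are Bernoulli's inequality, for the ratios \<open>P / a\<close> and
  \<open>a / (a + d)\<close>. Linearity in \<open>d\<close> is the point: \<open>d\<close> will be a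
  multiple of \<open>u ^ n\<close> or of \<open>- u'\<close>, to be absorbed by exact derivatives;
  \<open>M\<close> only freezes the coefficient.\<close>

lemma power_bounds_near:
  fixes a :: real
  assumes a: "a > 0" and P: "P \<ge> 0"
  shows power_lower_linear: "a - P \<le> d \<Longrightarrow> a ^ k - P ^ k \<le> real k * a ^ k / a * d"
    and power_upper_linear: "P \<le> a + d \<Longrightarrow> 0 \<le> d \<Longrightarrow> d \<le> M \<Longrightarrow> P ^ k - a ^ k \<le> real k * (a + M) ^ k / a * d"
proof -
  assume d: "a - P \<le> d"
  have "1 + real k * (P / a - 1) \<le> (1 + (P / a - 1)) ^ k"
    using a P by (intro Bernoulli_inequality) simp
  then have "a ^ k * (1 + real k * (P / a - 1)) \<le> a ^ k * (P / a) ^ k"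
    using a by (intro mult_left_mono) auto
  also have "\<dots> = P ^ k" using a by (simp flip: power_mult_distrib)
  finally have "a ^ k - P ^ k \<le> real k * a ^ k / a * (a - P)" using a by (simp add: field_simps)
  also have "\<dots> \<le> real k * a ^ k / a * d" using d a by (intro mult_left_mono) auto
  finally show "a ^ k - P ^ k \<le> real k * a ^ k / a * d" .
next
  assume d: "P \<le> a + d" "0 \<le> d" "d \<le> M"
  have "1 + real k * (a / (a + d) - 1) \<le> (1 + (a / (a + d) - 1)) ^ k"
    using a d by (intro Bernoulli_inequality) simp
  then have "(a + d) ^ k * (1 + real k * (a / (a + d) - 1)) \<le> (a + d) ^ k * (a / (a + d)) ^ k"
    using a d by (intro mult_left_mono) auto
  also have "\<dots> = a ^ k" using a d by (simp flip: power_mult_distrib)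
  finally have "(a + d) ^ k - a ^ k \<le> (a + d) ^ k * (real k * (1 - a / (a + d)))"
    by (simp add: algebra_simps)
  also have "1 - a / (a + d) = d / (a + d)" using a d by (simp add: field_simps)
  also have "(a + d) ^ k * (real k * (d / (a + d))) \<le> (a + M) ^ k * (real k * (d / a))"
    using a d by (intro mult_mono power_mono divide_left_mono) auto
  also have "\<dots> = real k * (a + M) ^ k / a * d" by simp
  finally have "(a + d) ^ k - a ^ k \<le> real k * (a + M) ^ k / a * d" .
  moreover have "P ^ k \<le> (a + d) ^ k" using P d by (intro power_mono) auto
  ultimately show "P ^ k - a ^ k \<le> real k * (a + M) ^ k / a * d" by linarith
qed

section \<open>The deposition system in the original time\<close>

locale deposition =
  fixes n :: nat and \<alpha> :: real and c :: "nat \<Rightarrow> real \<Rightarrow> real"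
  assumes n2: "n \<ge> 2" and alpha: "\<alpha> > 0" and sol: "deposition_solution n \<alpha> c"
    and init: "\<And>j. j \<ge> n \<Longrightarrow> c j 0 = 0"
begin

definition u :: "real \<Rightarrow> real" where "u = c 1"
definition S :: "real \<Rightarrow> real" where "S t = (\<Sum>i. c (n + i) t)"
definition \<tau> :: "real \<Rightarrow> real" where "\<tau> = new_time c"

lemma u_nonneg: "t \<ge> 0 \<Longrightarrow> u t \<ge> 0"
  and c_nonneg: "t \<ge> 0 \<Longrightarrow> j \<ge> n \<Longrightarrow> c j t \<ge> 0"
  and c_summable: "t \<ge> 0 \<Longrightarrow> summable (\<lambda>i. c (n + i) t)"
  and deriv_u: "t \<ge> 0 \<Longrightarrow> (u has_real_derivative \<alpha> - real n * u t ^ n - u t * S t) (at t within {0..})"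
  and deriv_c0: "t \<ge> 0 \<Longrightarrow> (c n has_real_derivative u t ^ n - u t * c n t) (at t within {0..})"
  and deriv_c: "t \<ge> 0 \<Longrightarrow> j \<ge> n + 1 \<Longrightarrow> (c j has_real_derivative u t * c (j - 1) t - u t * c j t) (at t within {0..})"
  using sol unfolding deposition_solution_def u_def S_def by auto

lemma cont_u: "continuous_on {0..} u"
  using deriv_u by (rule has_real_derivative_half_line_continuous)

lemma cont_c: "continuous_on {0..} (c (n + k))"
proof (cases k)
  case 0
  then show ?thesis using has_real_derivative_half_line_continuous[OF deriv_c0] by simp
next
  case (Suc m)
  then show ?thesis using has_real_derivative_half_line_continuous[OF deriv_c[of _ "n + k"]] by simp
qed

lemma deriv_tau: "t \<ge> 0 \<Longrightarrow> (\<tau> has_real_derivative u t) (at t within {0..})"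
  using integral_half_line_deriv[OF cont_u] unfolding \<tau>_def new_time_def[abs_def] u_def .

lemma tau_0: "\<tau> 0 = 0"
  by (simp add: \<tau>_def new_time_def)

lemma deriv_partial_sum:
  assumes "t \<ge> 0"
  shows "((\<lambda>t. \<Sum>i\<le>N. c (n + i) t) has_real_derivative u t ^ n - u t * c (n + N) t) (at t within {0..})"
proof (induction N)
  case 0
  then show ?case using deriv_c0[OF assms] by simp
next
  case (Suc N)
  show ?case
    using DERIV_add[OF Suc deriv_c[OF assms, of "n + Suc N"]] by simp
qed

text \<open>The series is not differentiated term by term. A partial sum loses mass only through its
  last index, and the integrated loss \<open>u * c (n + N)\<close> tends to 0 by dominated
  convergence: pointwise because the series converges, dominated because one term is at most the
  partial sum and hence at most the total input.\<close>

lemma S_eq_integral: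
  assumes t: "t \<ge> 0"
  shows "S t = integral {0..t} (\<lambda>s. u s ^ n)"
proof -
  have cu: "continuous_on {0..x} u" for x by (rule continuous_on_subset[OF cont_u]) auto
  have cc: "continuous_on {0..x} (c (n + N))" for x N by (rule continuous_on_subset[OF cont_c]) auto
  have iu: "(\<lambda>s. u s ^ n) integrable_on {0..x}" for x
    by (intro integrable_continuous_interval continuous_intros cu)
  have ic: "(\<lambda>s. u s * c (n + N) s) integrable_on {0..x}" for x N
    by (intro integrable_continuous_interval continuous_intros cu cc)
  have part: "(\<Sum>i\<le>N. c (n + i) x) = integral {0..x} (\<lambda>s. u s ^ n) - integral {0..x} (\<lambda>s. u s * c (n + N) s)"
    if x: "x \<ge> 0" for x N
  proof -
    have "((\<lambda>s. u s ^ n - u s * c (n + N) s) has_integral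
      (\<Sum>i\<le>N. c (n + i) x) - (\<Sum>i\<le>N. c (n + i) 0)) {0..x}"
    proof (rule fundamental_theorem_of_calculus[OF x])
      fix s assume "s \<in> {0..x}"
      then show "((\<lambda>t. \<Sum>i\<le>N. c (n + i) t) has_vector_derivative u s ^ n - u s * c (n + N) s) (at s within {0..x})"
        using has_field_derivative_subset[OF deriv_partial_sum[of s N], of "{0..x}"]
        by (auto simp: has_real_derivative_iff_has_vector_derivative)
    qed
    then have "integral {0..x} (\<lambda>s. u s ^ n - u s * c (n + N) s) = (\<Sum>i\<le>N. c (n + i) x)"
      using init by (auto dest!: integral_unique)
    then show ?thesis using integral_diff[OF iu ic] by simp
  qed
  define M where "M = integral {0..t} (\<lambda>s. u s ^ n)"
  have bound: "c (n + N) x \<le> M" if x: "0 \<le> x" "x \<le> t" for x N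
  proof -
    have "c (n + N) x \<le> (\<Sum>i\<le>N. c (n + i) x)"
      using c_nonneg[OF x(1)] by (intro member_le_sum) auto
    also have "\<dots> \<le> integral {0..x} (\<lambda>s. u s ^ n)"
      unfolding part[OF x(1)] using c_nonneg u_nonneg by (auto intro!: integral_nonneg ic)
    also have "\<dots> \<le> M"
      unfolding M_def using x u_nonneg by (intro integral_subset_le iu) auto
    finally show ?thesis .
  qed
  have "(\<lambda>N. integral {0..t} (\<lambda>s. u s * c (n + N) s)) \<longlonglongrightarrow> integral {0..t} (\<lambda>s. 0 :: real)"
  proof (rule dominated_convergence(2)[where h = "\<lambda>s. u s * M"])
    show "(\<lambda>s. u s * M) integrable_on {0..t}" by (intro integrable_continuous_interval continuous_intros cu)
    fix N s assume "s \<in> {0..t}"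
    then show "norm (u s * c (n + N) s) \<le> u s * M"
      using u_nonneg[of s] c_nonneg[of s "n + N"] bound[of s N] by (auto simp: abs_mult intro!: mult_left_mono)
  next
    fix s assume "s \<in> {0..t}"
    then have "(\<lambda>N. c (n + N) s) \<longlonglongrightarrow> 0" using summable_LIMSEQ_zero[OF c_summable[of s]] by simp
    from tendsto_mult_right_zero[OF this] show "(\<lambda>N. u s * c (n + N) s) \<longlonglongrightarrow> 0" .
  qed (rule ic)
  then have "(\<lambda>N. \<Sum>i\<le>N. c (n + i) t) \<longlonglongrightarrow> M - 0"
    unfolding part[OF t] M_def by (intro tendsto_diff tendsto_const) simp
  moreover have "(\<lambda>N. \<Sum>i\<le>N. c (n + i) t) \<longlonglongrightarrow> S t"
    unfolding S_def by (rule summable_LIMSEQ'[OF c_summable[OF t]])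
  ultimately show ?thesis using LIMSEQ_unique unfolding M_def by fastforce
qed

lemma deriv_S: 
  assumes "t \<ge> 0"
  shows "(S has_real_derivative u t ^ n) (at t within {0..})"
proof -
  have "continuous_on {0..} (\<lambda>s. u s ^ n)" by (intro continuous_intros cont_u)
  from integral_half_line_deriv[OF this assms] show ?thesis
    by (rule has_field_derivative_transform_within[where d = 1]) (use S_eq_integral assms in auto)
qed

lemma S_0: "S 0 = 0"
  using S_eq_integral[of 0] by simp

lemma cont_S: "continuous_on {0..} S"
  using deriv_S by (rule has_real_derivative_half_line_continuous)

lemma S_nonneg: "t \<ge> 0 \<Longrightarrow> S t \<ge> 0"
  unfolding S_def using c_nonneg by (intro suminf_nonneg c_summable) auto

text \<open>At a positive time with \<open>u = 0\<close> the equation gives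
  \<open>u' = \<alpha> > 0\<close>, so \<open>u\<close> would be negative just before.\<close>

lemma u_pos:
  assumes "t > 0"
  shows "u t > 0"
proof (rule ccontr)
  assume "\<not> u t > 0"
  then have 0: "u t = 0" using u_nonneg[of t] assms by simp
  have "(u has_real_derivative \<alpha>) (at t)"
    using has_real_derivative_half_line_at[OF deriv_u assms] assms n2 0 by (simp add: zero_power)
  then obtain d where d: "d > 0" "\<forall>h>0. h < d \<longrightarrow> u (t - h) < u t"
    using DERIV_pos_inc_left alpha by blast
  define h where "h = min d t / 2"
  have "h > 0" "h < d" "h < t" using d assms by (auto simp: h_def)
  then show False using d(2) 0 u_nonneg[of "t - h"] by fastforce
qed

text \<open>The second entry is the equilibrium of the linear majorant
  \<open>u' \<le> (\<alpha> - n + n^2) - n^2 * u\<close>, which Bernoulli's inequality at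
  \<open>u = 1\<close> provides.\<close>

definition B :: real where "B = max (u 0) ((\<alpha> - real n + real n ^ 2) / real n ^ 2)"

lemma u_le: 
  assumes "t \<ge> 0"
  shows "u t \<le> B"
  unfolding B_def
proof (rule linear_decay_bound[OF deriv_u _ _ order_refl assms])
  fix x :: real assume x: "0 < x"
  have "1 + real n * (u x - 1) \<le> (1 + (u x - 1)) ^ n"
    using u_nonneg[of x] x by (intro Bernoulli_inequality) auto
  then have "real n * (1 + real n * (u x - 1)) \<le> real n * u x ^ n"
    by (intro mult_left_mono) auto
  moreover have "u x * S x \<ge> 0" using u_nonneg[of x] S_nonneg[of x] x by simp
  ultimately show "\<alpha> - real n * u x ^ n - u x * S x \<le> (\<alpha> - real n + real n ^ 2) - real n ^ 2 * u x"
    by (simp add: power2_eq_square algebra_simps)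
qed (use n2 in auto)

lemma B_nonneg: "B \<ge> 0"
  using u_nonneg[of 0] u_le[of 0] by simp

lemma tau_nonneg: "t \<ge> 0 \<Longrightarrow> \<tau> t \<ge> 0"
  using half_line_nondecreasing[OF deriv_tau, of 0 t] u_nonneg by (simp add: tau_0)

lemma tau_less: "0 \<le> s \<Longrightarrow> s < t \<Longrightarrow> \<tau> s < \<tau> t"
  using half_line_increasing[OF deriv_tau, of s t] u_pos by simp

lemma S_pos: "t > 0 \<Longrightarrow> S t > 0"
  using half_line_increasing[OF deriv_S, of 0 t] u_pos by (simp add: S_0)

text \<open>In the new time \<open>S\<close> has slope \<open>u ^ (n - 1)\<close>. This crude linear
  bound suffices, as it serves only while \<tau> is assumed bounded and inside a logarithm.\<close>

lemma S_le_tau: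
  assumes "t \<ge> 0"
  shows "S t \<le> B ^ (n - 1) * \<tau> t"
proof -
  have "B ^ (n - 1) * \<tau> 0 - S 0 \<le> B ^ (n - 1) * \<tau> t - S t"
  proof (rule half_line_nondecreasing[where f' = "\<lambda>x. B ^ (n - 1) * u x - u x ^ n", OF _ _ order_refl assms])
    fix x :: real assume x: "0 < x"
    have "u x ^ n = u x ^ (n - 1) * u x" using n2 by (cases n) (auto simp: mult.commute)
    also have "\<dots> \<le> B ^ (n - 1) * u x"
      using x u_nonneg[of x] u_le[of x] by (intro mult_right_mono power_mono) auto
    finally show "0 \<le> B ^ (n - 1) * u x - u x ^ n" by simp
  next
    fix x :: real assume x: "0 \<le> x"
    show "((\<lambda>x. B ^ (n - 1) * \<tau> x - S x) has_real_derivative B ^ (n - 1) * u x - u x ^ n) (at x within {0..})"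
      by (intro derivative_intros DERIV_cmult deriv_tau deriv_S x)
  qed
  then show ?thesis by (simp add: tau_0 S_0)
qed

text \<open>If \<tau> stayed below \<open>M\<close>, then \<open>S\<close> would be bounded and all
  losses of \<open>u\<close> would be at most \<open>L * u = L * \<tau>'\<close>. So
  \<open>u - \<alpha> * t + L * \<tau>\<close> would be nondecreasing, forcing linear growth on the
  bounded \<open>u\<close>.\<close>

lemma tau_unbounded: "\<exists>t\<ge>0. \<tau> t > M"
proof (rule ccontr)
  assume "\<not> ?thesis"
  then have M: "\<tau> t \<le> M" if "t \<ge> 0" for t using that by force
  then have M0: "M \<ge> 0" using tau_nonneg[of 0] by force
  define L where "L = real n * B ^ (n - 1) + B ^ (n - 1) * M"
  have L: "L \<ge> 0" unfolding L_def using B_nonneg M0 by simp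
  have *: "u 0 - \<alpha> * 0 + L * \<tau> 0 \<le> u t - \<alpha> * t + L * \<tau> t" if t: "t \<ge> 0" for t
  proof (rule half_line_nondecreasing[where f' = "\<lambda>x. (\<alpha> - real n * u x ^ n - u x * S x) - \<alpha> * 1 + L * u x", OF _ _ order_refl t])
    fix x :: real assume x: "0 \<le> x"
    show "((\<lambda>x. u x - \<alpha> * x + L * \<tau> x) has_real_derivative (\<alpha> - real n * u x ^ n - u x * S x) - \<alpha> * 1 + L * u x) (at x within {0..})"
      by (intro DERIV_add DERIV_diff DERIV_cmult DERIV_ident deriv_tau deriv_u x)
  next
    fix x :: real assume x: "0 < x"
    have "u x ^ n = u x ^ (n - 1) * u x" using n2 by (cases n) (auto simp: mult.commute)
    also have "\<dots> \<le> B ^ (n - 1) * u x"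
      using x u_nonneg[of x] u_le[of x] by (intro mult_right_mono power_mono) auto
    finally have 1: "real n * u x ^ n \<le> real n * (B ^ (n - 1) * u x)" by (intro mult_left_mono) auto
    have "S x \<le> B ^ (n - 1) * M"
      using S_le_tau[of x] M[of x] x B_nonneg mult_left_mono[of "\<tau> x" M "B ^ (n - 1)"] by force
    then have "u x * S x \<le> u x * (B ^ (n - 1) * M)" using u_nonneg[of x] x by (intro mult_left_mono) auto
    with 1 show "0 \<le> (\<alpha> - real n * u x ^ n - u x * S x) - \<alpha> * 1 + L * u x"
      unfolding L_def by (simp add: algebra_simps)
  qed
  define t where "t = (B + L * M + 1) / \<alpha>"
  have t: "t \<ge> 0" unfolding t_def using B_nonneg L M0 alpha by simp
  have "u 0 \<le> u t - \<alpha> * t + L * \<tau> t" using *[OF t] by (simp add: tau_0)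
  moreover have "\<alpha> * t = B + L * M + 1" using alpha by (simp add: t_def)
  moreover have "L * \<tau> t \<le> L * M" using M[OF t] L by (intro mult_left_mono)
  ultimately show False using u_nonneg[of 0] u_le[OF t] by simp
qed

section \<open>Long-time behaviour of u and S\<close>

definition p :: "real \<Rightarrow> real" where "p t = \<alpha> - real n * u t ^ n - u t * S t"

text \<open>This is the second derivative of \<open>u\<close>, linear in \<open>p\<close> because
  \<open>S' = u ^ n\<close>. The damping keeps \<open>- p\<close> bounded, and the sign of the
  source \<open>- u ^ (n + 1)\<close> keeps a nonpositive \<open>p\<close> nonpositive.\<close>

lemma deriv_p:
  assumes "t \<ge> 0"
  shows "(p has_real_derivative - (real n ^ 2 * u t ^ (n - 1) + S t) * p t - u t ^ (n + 1)) (at t within {0..})"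
proof -
  have "(p has_real_derivative 0 - real n * (real n * (p t * u t ^ (n - Suc 0))) - (p t * S t + u t ^ n * u t)) (at t within {0..})"
    unfolding p_def[abs_def]
    by (intro DERIV_diff DERIV_const DERIV_cmult DERIV_power DERIV_mult deriv_S deriv_u assms)
  moreover have "0 - real n * (real n * (p t * u t ^ (n - Suc 0))) - (p t * S t + u t ^ n * u t)
     = - (real n ^ 2 * u t ^ (n - 1) + S t) * p t - u t ^ (n + 1)"
    by (simp add: power2_eq_square algebra_simps)
  ultimately show ?thesis by (rule DERIV_cong)
qed

text \<open>The sign of \<open>p = u'\<close> can only change from positive to negative, by its linear equation; it
  cannot stay positive, since then \<open>S\<close> would grow linearly.\<close>

lemma p_eventually_nonpos: "\<exists>s>0. \<forall>t\<ge>s. p t \<le> 0"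
proof -
  \<comment> \<open>Time 1 stands for any positive time: the argument needs \<open>u 1 > 0\<close>,
    whereas \<open>u 0\<close> may vanish.\<close>
  have "\<exists>s\<ge>1. p s \<le> 0"
  proof (rule ccontr)
    assume "\<not> ?thesis"
    then have pp: "p t > 0" if "t \<ge> 1" for t using that by force
    have u1: "u 1 \<le> u t" if "t \<ge> 1" for t
      by (rule half_line_nondecreasing[OF deriv_u _ _ that]) (use pp in \<open>auto simp: p_def less_imp_le\<close>)
    have u1p: "u 1 > 0" using u_pos by simp
    have S1: "S 1 - u 1 ^ n * 1 \<le> S t - u 1 ^ n * t" if "t \<ge> 1" for t
    proof (rule half_line_nondecreasing[where f' = "\<lambda>x. u x ^ n - u 1 ^ n * 1", OF _ _ _ that])
      fix x :: real assume "0 \<le> x"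
      then show "((\<lambda>x. S x - u 1 ^ n * x) has_real_derivative u x ^ n - u 1 ^ n * 1) (at x within {0..})"
        by (intro DERIV_diff DERIV_cmult DERIV_ident deriv_S)
    next
      fix x :: real assume "1 < x"
      then have "u 1 ^ n \<le> u x ^ n" using u1[of x] u1p by (intro power_mono) auto
      then show "0 \<le> u x ^ n - u 1 ^ n * 1" by simp
    qed simp
    \<comment> \<open>\<open>S\<close> has grown with slope at least \<open>u 1 ^ n\<close> since
      time 1, so by this time \<open>u 1 * S t\<close> has reached \<alpha>, which excludes
      \<open>p t > 0\<close>.\<close>
    define t where "t = 1 + \<alpha> / (u 1 * u 1 ^ n)"
    have t: "t \<ge> 1" using alpha u1p by (simp add: t_def)
    have "\<alpha> = u 1 * (u 1 ^ n * (t - 1))" using u1p by (simp add: t_def)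
    also have "\<dots> \<le> u 1 * S t"
      using S1[OF t] S_nonneg[of 1] u1p by (intro mult_left_mono) (auto simp: algebra_simps)
    also have "\<dots> \<le> u t * S t" using u1[OF t] S_nonneg[of t] t by (intro mult_right_mono) auto
    finally have "\<alpha> \<le> u t * S t" .
    moreover have "real n * u t ^ n \<ge> 0" using u_nonneg[of t] t by simp
    ultimately have "p t \<le> 0" unfolding p_def by linarith
    then show False using pp[OF t] by simp
  qed
  then obtain s where s: "s \<ge> 1" "p s \<le> 0" by blast
  define h where "h = (\<lambda>t. real n ^ 2 * u t ^ (n - 1) + S t)"
  have ch: "continuous_on {0..} h" unfolding h_def by (intro continuous_intros cont_u cont_S)
  define W where "W = (\<lambda>t. integral {0..t} h)"
  have dW: "(W has_real_derivative h t) (at t within {0..})" if "t \<ge> 0" for t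
    unfolding W_def by (rule integral_half_line_deriv[OF ch that])
  have "p t \<le> 0" if "t \<ge> s" for t
  proof -
    have "- (p s * exp (W s)) \<le> - (p t * exp (W t))"
    proof (rule half_line_nondecreasing[where f' = "\<lambda>x. u x ^ (n + 1) * exp (W x)", OF _ _ _ that])
      fix x :: real assume x: "0 \<le> x"
      have dp: "(p has_real_derivative - h x * p x - u x ^ (n + 1)) (at x within {0..})"
        using deriv_p[OF x] by (simp only: h_def)
      have de: "((\<lambda>x. exp (W x)) has_real_derivative exp (W x) * h x) (at x within {0..})"
        using dW[OF x] by (auto intro!: derivative_eq_intros)
      have "((\<lambda>x. - (p x * exp (W x))) has_real_derivative
         - ((- h x * p x - u x ^ (n + 1)) * exp (W x) + exp (W x) * h x * p x)) (at x within {0..})"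
        by (intro DERIV_minus DERIV_mult dp de)
      then show "((\<lambda>x. - (p x * exp (W x))) has_real_derivative u x ^ (n + 1) * exp (W x)) (at x within {0..})"
        by (rule DERIV_cong) (simp add: algebra_simps)
    next
      fix x :: real assume "s < x"
      then show "0 \<le> u x ^ (n + 1) * exp (W x)" using u_nonneg[of x] s by simp
    qed (use s in auto)
    moreover have "p s * exp (W s) \<le> 0" using s by (simp add: mult_nonpos_nonneg)
    ultimately have "p t * exp (W t) \<le> 0" by linarith
    then show ?thesis by (simp add: mult_le_0_iff)
  qed
  then show ?thesis using s by (intro exI[of _ s]) auto
qed

text \<open>Write \<open>P = u * S\<close>, so that \<open>(S ^ n)' = n * u * P ^ (n - 1)\<close> while \<open>P = \<alpha> - n * u ^ n - u'\<close>. Once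
  \<open>u' \<le> 0\<close>, the error from \<open>u'\<close> is absorbed by the exact derivative of \<open>u\<^sup>2\<close>, and the error from
  \<open>u ^ n\<close> by that of \<open>ln S\<close>, because \<open>u\<close> is at most a constant over \<open>S\<close>.\<close>

lemma S_power_asymptotics:
  "\<exists>C\<ge>0. \<forall>t\<ge>0. \<bar>S t ^ n - real n * \<alpha> ^ (n - 1) * \<tau> t\<bar> \<le> C * (1 + ln (1 + \<tau> t))"
proof -
  obtain s where s: "s > 0" "\<And>t. t \<ge> s \<Longrightarrow> p t \<le> 0" using p_eventually_nonpos by blast
  \<comment> \<open>After \<open>s\<close> the damping is at least \<open>S s\<close> and the source
    at most \<open>B ^ (n + 1)\<close>; the second entry is the resulting equilibrium for
    \<open>- p\<close>.\<close>
  define M0 where "M0 = max (- p s) (B ^ (n + 1) / S s)"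
  have Ss: "S s > 0" using S_pos s by simp
  have S_mono: "S s \<le> S t" if "s \<le> t" for t
    using half_line_nondecreasing[OF deriv_S, of s t] u_nonneg s that by simp
  have M0: "- p t \<le> M0" if t: "t \<ge> s" for t
    unfolding M0_def
  proof (rule linear_decay_bound[where f = "\<lambda>t. - p t"
        and f' = "\<lambda>t. - (- (real n ^ 2 * u t ^ (n - 1) + S t) * p t - u t ^ (n + 1))", OF _ _ Ss _ t])
    show "((\<lambda>t. - p t) has_real_derivative - (- (real n ^ 2 * u x ^ (n - 1) + S x) * p x - u x ^ (n + 1))) (at x within {0..})"
      if "0 \<le> x" for x
      by (rule DERIV_minus[OF deriv_p[OF that]])
    show "- (- (real n ^ 2 * u x ^ (n - 1) + S x) * p x - u x ^ (n + 1)) \<le> B ^ (n + 1) - S s * - p x" if x: "s < x" for x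
    proof -
      have "u x ^ (n + 1) \<le> B ^ (n + 1)" using x s u_nonneg[of x] u_le[of x] by (intro power_mono) auto
      moreover have "S s * - p x \<le> (real n ^ 2 * u x ^ (n - 1) + S x) * - p x"
      proof (rule mult_right_mono)
        have "0 \<le> real n ^ 2 * u x ^ (n - 1)" using u_nonneg[of x] x s by simp
        then show "S s \<le> real n ^ 2 * u x ^ (n - 1) + S x" using S_mono[of x] x by linarith
      qed (use s(2)[of x] x in auto)
      moreover have "- (- X * p x - U) = U - X * - p x" for X U :: real by (simp add: algebra_simps)
      ultimately show ?thesis by (simp only:)
    qed
  qed (use s in auto)
  have M0n: "M0 \<ge> 0" using M0[of s] s(2)[of s] by simp
  define M where "M = \<alpha> + M0"
  have P_eq: "u t * S t = \<alpha> - real n * u t ^ n - p t" for t by (simp add: p_def)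
  have P_nonneg: "u t * S t \<ge> 0" if "t \<ge> s" for t using u_nonneg[of t] S_nonneg[of t] s that by simp
  have P_le: "u t * S t \<le> \<alpha> + - p t" if "t \<ge> s" for t
    unfolding P_eq using u_nonneg[of t] s that by simp
  have P_ge: "\<alpha> - u t * S t \<le> real n * u t ^ n" if "t \<ge> s" for t
    unfolding P_eq using s(2)[OF that] by simp
  define K1 where "K1 = real (n - 1) * \<alpha> ^ (n - 1) / \<alpha> * real n"
  define K2 where "K2 = real (n - 1) * (\<alpha> + M0) ^ (n - 1) / \<alpha>"
  have K1: "\<alpha> ^ (n - 1) - (u t * S t) ^ (n - 1) \<le> K1 * u t ^ n" if "t \<ge> s" for t
    using power_lower_linear[OF alpha P_nonneg[OF that] P_ge[OF that], of "n - 1"]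
    by (simp add: K1_def mult.assoc)
  have K2: "(u t * S t) ^ (n - 1) - \<alpha> ^ (n - 1) \<le> K2 * - p t" if "t \<ge> s" for t
    using power_upper_linear[OF alpha P_nonneg[OF that] P_le[OF that] _ M0[OF that], of "n - 1"] s(2)[OF that]
    by (simp add: K2_def)
  have dSn: "((\<lambda>t. S t ^ n) has_real_derivative real n * u t * (u t * S t) ^ (n - 1)) (at t within {0..})"
    if "t \<ge> 0" for t
  proof -
    have "((\<lambda>t. S t ^ n) has_real_derivative real n * (u t ^ n * S t ^ (n - Suc 0))) (at t within {0..})"
      by (rule DERIV_power[OF deriv_S[OF that]])
    moreover have "u t ^ n = u t * u t ^ (n - 1)" using n2 by (cases n) auto
    ultimately show ?thesis by (simp add: power_mult_distrib mult_ac)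
  qed
  define F where "F = (\<lambda>t. S t ^ n - real n * \<alpha> ^ (n - 1) * \<tau> t)"
  define F' where "F' = (\<lambda>t. real n * u t * (u t * S t) ^ (n - 1) - real n * \<alpha> ^ (n - 1) * u t)"
  have dF: "(F has_real_derivative F' t) (at t within {0..})" if "t \<ge> 0" for t
    unfolding F_def F'_def by (intro DERIV_diff dSn DERIV_cmult deriv_tau that)
  have F'_eq: "F' t = real n * u t * ((u t * S t) ^ (n - 1) - \<alpha> ^ (n - 1))" for t
    by (simp add: F'_def algebra_simps)
  \<comment> \<open>Here \<open>F' \<le> - n * K2 * u * u'\<close>, and the right side is the
    derivative of \<open>- n * K2 / 2 * u^2\<close>. No decay of \<open>u'\<close> has to be
    known.\<close>
  have upper: "F t \<le> F s + real n * K2 / 2 * u s ^ 2" if t: "t \<ge> s" for t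
  proof -
    have "- F s - real n * K2 / 2 * u s ^ 2 \<le> - F t - real n * K2 / 2 * u t ^ 2"
    proof (rule half_line_nondecreasing[where f' = "\<lambda>t. - F' t - real n * K2 / 2 * (real 2 * (p t * u t ^ (2 - Suc 0)))", OF _ _ _ t])
      fix x :: real assume x: "0 \<le> x"
      show "((\<lambda>t. - F t - real n * K2 / 2 * u t ^ 2) has_real_derivative
          - F' x - real n * K2 / 2 * (real 2 * (p x * u x ^ (2 - Suc 0)))) (at x within {0..})"
        unfolding p_def by (intro DERIV_diff DERIV_minus dF DERIV_cmult DERIV_power deriv_u x)
    next
      fix x :: real assume x: "s < x"
      have "real n * u x * ((u x * S x) ^ (n - 1) - \<alpha> ^ (n - 1)) \<le> real n * u x * (K2 * - p x)"
        using K2[of x] x u_nonneg[of x] s by (intro mult_left_mono) auto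
      then show "0 \<le> - F' x - real n * K2 / 2 * (real 2 * (p x * u x ^ (2 - Suc 0)))"
        unfolding F'_eq by (simp add: algebra_simps)
    qed (use s in auto)
    moreover have "K2 \<ge> 0" unfolding K2_def using alpha M0n by simp
    then have "real n * K2 / 2 * u t ^ 2 \<ge> 0" by simp
    ultimately show ?thesis by linarith
  qed
  have K1n: "K1 \<ge> 0" unfolding K1_def using alpha by simp
  define D where "D = real n * K1 * M"
  have Dn: "D \<ge> 0" unfolding D_def M_def using K1n alpha M0n by simp
  \<comment> \<open>Here \<open>F' \<ge> - n * K1 * u ^ (n + 1)\<close>; trading one factor
    \<open>u\<close> for \<open>M / S\<close> leaves \<open>- D * u ^ n / S\<close>, the derivative
    of \<open>- D * ln S\<close>.\<close>
  have lower: "F s + D * ln (S s) \<le> F t + D * ln (S t)" if t: "t \<ge> s" for t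
  proof (rule DERIV_nonneg_imp_increasing_open[OF t])
    have "continuous_on {s..t} F"
      using has_real_derivative_half_line_continuous[OF dF] s by (auto intro: continuous_on_subset)
    moreover have "continuous_on {s..t} S" using cont_S s by (auto intro: continuous_on_subset)
    ultimately show "continuous_on {s..t} (\<lambda>t. F t + D * ln (S t))"
    proof (intro continuous_intros ballI)
      fix x assume "x \<in> {s..t}"
      then show "S x \<noteq> 0" using S_pos[of x] s(1) by auto
    qed
    fix x assume x: "s < x" "x < t"
    then have x0: "x > 0" using s by simp
    have Sx: "S x > 0" using S_pos x0 .
    have "((\<lambda>t. F t + D * ln (S t)) has_real_derivative F' x + D * (1 / S x * u x ^ n)) (at x)"
      by (rule DERIV_add[OF has_real_derivative_half_line_at[OF dF x0] DERIV_cmult[OF DERIV_chain2[where f = ln and g = S, OF DERIV_ln_divide[OF Sx] has_real_derivative_half_line_at[OF deriv_S x0]]]])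
        (use x0 in auto)
    moreover have "0 \<le> F' x + D * (1 / S x * u x ^ n)"
    proof -
      have "real n * u x * (\<alpha> ^ (n - 1) - (u x * S x) ^ (n - 1)) \<le> real n * u x * (K1 * u x ^ n)"
        using K1[of x] x u_nonneg[of x] s by (intro mult_left_mono) auto
      also have "\<dots> = real n * K1 * u x ^ n * u x" by simp
      also have "\<dots> \<le> real n * K1 * u x ^ n * (M / S x)"
      proof (rule mult_left_mono)
        have "u x * S x \<le> M" using P_le[of x] M0[of x] x by (simp add: M_def)
        then show "u x \<le> M / S x" using Sx by (simp add: field_simps)
        show "0 \<le> real n * K1 * u x ^ n" using K1n u_nonneg[of x] x0 by simp
      qed
      also have "\<dots> = D * (1 / S x * u x ^ n)" by (simp add: D_def)
      finally show ?thesis unfolding F'_eq by (simp add: algebra_simps)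
    qed
    ultimately show "\<exists>y. ((\<lambda>t. F t + D * ln (S t)) has_real_derivative y) (at x) \<and> 0 \<le> y" by blast
  qed
  define b where "b = B ^ (n - 1)"
  have b0: "b \<ge> 0" using B_nonneg by (simp add: b_def)
  have lnS: "ln (S t) \<le> ln (1 + b) + ln (1 + \<tau> t)" if "t > 0" for t
  proof -
    have tn: "\<tau> t \<ge> 0" using tau_nonneg that by simp
    have "S t \<le> b * \<tau> t" using S_le_tau[of t] that by (simp add: b_def)
    also have "\<dots> \<le> (1 + b) * (1 + \<tau> t)" using b0 tn by (simp add: algebra_simps)
    finally have "ln (S t) \<le> ln ((1 + b) * (1 + \<tau> t))" using S_pos[OF that] by simp
    also have "\<dots> = ln (1 + b) + ln (1 + \<tau> t)" using b0 tn by (intro ln_mult_pos) auto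
    finally show ?thesis .
  qed
  \<comment> \<open>The last two terms are for times before \<open>s\<close>, where monotonicity of
    \<open>S\<close> and \<tau> bounds \<open>F\<close>.\<close>
  define A where "A = \<bar>F s\<bar> + \<bar>real n * K2 / 2 * u s ^ 2\<bar> + D * \<bar>ln (S s)\<bar> + D * ln (1 + b) + S s ^ n + real n * \<alpha> ^ (n - 1) * \<tau> s"
  have nn: "0 \<le> D * \<bar>ln (S s)\<bar>" "0 \<le> D * ln (1 + b)" "0 \<le> S s ^ n" "0 \<le> real n * \<alpha> ^ (n - 1) * \<tau> s"
    using Dn b0 Ss alpha tau_nonneg[of s] s by auto
  have A0: "A \<ge> 0" using nn unfolding A_def by linarith
  have "\<bar>F t\<bar> \<le> (A + D) * (1 + ln (1 + \<tau> t))" if t: "t \<ge> 0" for t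
  proof -
    have l0: "ln (1 + \<tau> t) \<ge> 0" using tau_nonneg[OF t] by simp
    have "\<bar>F t\<bar> \<le> A + D * ln (1 + \<tau> t)"
    proof (cases "t \<ge> s")
      case True
      have "F t \<le> A" using upper[OF True] nn unfolding A_def by linarith
      moreover have "D * ln (S t) \<le> D * ln (1 + b) + D * ln (1 + \<tau> t)"
        using mult_left_mono[OF lnS[of t] Dn] s True by (simp add: distrib_left)
      moreover have "D * ln (S s) \<ge> - (D * \<bar>ln (S s)\<bar>)"
        using mult_left_mono[OF _ Dn, of "- \<bar>ln (S s)\<bar>" "ln (S s)"] by simp
      moreover have "0 \<le> D * ln (1 + \<tau> t)" using Dn l0 by simp
      ultimately show ?thesis using lower[OF True] nn unfolding A_def by linarith
    next
      case False
      have "S t \<le> S s" using half_line_nondecreasing[OF deriv_S, of t s] u_nonneg t False by simp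
      then have 1: "S t ^ n \<le> S s ^ n" using S_nonneg[OF t] by (intro power_mono)
      have "\<tau> t \<le> \<tau> s" using tau_less[OF t, of s] False by simp
      then have 2: "real n * \<alpha> ^ (n - 1) * \<tau> t \<le> real n * \<alpha> ^ (n - 1) * \<tau> s"
        using alpha by (intro mult_left_mono) auto
      have 3: "0 \<le> S t ^ n" "0 \<le> real n * \<alpha> ^ (n - 1) * \<tau> t" using S_nonneg[OF t] tau_nonneg[OF t] alpha by auto
      have "0 \<le> D * ln (1 + \<tau> t)" using Dn l0 by simp
      then show ?thesis using 1 2 3 nn unfolding A_def F_def by linarith
    qed
    also have "\<dots> \<le> (A + D) * (1 + ln (1 + \<tau> t))" using A0 Dn l0 by (simp add: algebra_simps)
    finally show ?thesis .
  qed
  then show ?thesis using A0 Dn unfolding F_def by (intro exI[of _ "A + D"]) auto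
qed

section \<open>The inverse of the new time\<close>

definition g :: "real \<Rightarrow> real" where "g = inv_into {0..} \<tau>"

lemma
  assumes "x \<ge> 0"
  shows g_nonneg: "g x \<ge> 0" and tau_g: "\<tau> (g x) = x"
proof -
  \<comment> \<open>\<open>inv_into\<close> is meaningful only on the range, so every
    \<open>x \<ge> 0\<close> must be reached; unboundedness of \<tau> and the intermediate value
    theorem provide this.\<close>
  obtain t where t: "t \<ge> 0" "\<tau> t > x" using tau_unbounded by blast
  have "continuous_on {0..t} \<tau>"
    using has_real_derivative_half_line_continuous[OF deriv_tau] by (rule continuous_on_subset) auto
  then obtain y where "0 \<le> y" "\<tau> y = x"
    using IVT'[of \<tau> 0 x t] t assms tau_0 by auto
  then have x: "x \<in> \<tau> ` {0..}" by auto
  show "g x \<ge> 0" using inv_into_into[OF x] by (simp add: g_def)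
  show "\<tau> (g x) = x" using f_inv_into_f[OF x] by (simp add: g_def)
qed

lemma g_tau:
  assumes "t \<ge> 0"
  shows "g (\<tau> t) = t"
proof -
  have "inj_on \<tau> {0..}"
    using tau_less by (intro linorder_inj_onI) fastforce+
  then show ?thesis using assms by (simp add: g_def)
qed

lemma g_0: "g 0 = 0"
  using g_tau[of 0] by (simp add: tau_0)

lemma g_pos:
  assumes "x > 0"
  shows "g x > 0"
proof -
  have "g x \<noteq> 0" using tau_g[of x] assms tau_0 by auto
  then show ?thesis using g_nonneg[of x] assms by simp
qed

text \<open>The derivative of \<open>g\<close> will be available only for \<open>x > 0\<close>, so
  continuity up to 0 is taken from compactness: a continuous injection on \<open>{0..b}\<close> has
  a continuous inverse, and \<open>b\<close> is chosen with \<open>\<tau> b\<close> beyond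
  \<open>x\<close>.\<close>

lemma cont_g: "continuous_on {0..} g"
  unfolding continuous_on_eq_continuous_within
proof
  fix x :: real assume "x \<in> {0..}"
  then have x: "x \<ge> 0" by simp
  define b where "b = g x + 1"
  have b: "b \<ge> 0" "x < \<tau> b"
    using g_nonneg[OF x] tau_less[of "g x" b] tau_g[OF x] by (auto simp: b_def)
  have ct: "continuous_on {0..b} \<tau>"
    using has_real_derivative_half_line_continuous[OF deriv_tau] by (rule continuous_on_subset) auto
  have "continuous_on (\<tau> ` {0..b}) g"
    by (rule continuous_on_inv[OF ct]) (auto simp: g_tau)
  moreover have "{0..\<tau> b} \<subseteq> \<tau> ` {0..b}"
  proof
    fix y assume "y \<in> {0..\<tau> b}"
    then show "y \<in> \<tau> ` {0..b}" using IVT'[of \<tau> 0 y b] b ct tau_0 by force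
  qed
  ultimately have "continuous_on {0..\<tau> b} g" by (rule continuous_on_subset)
  then have "continuous (at x within {0..\<tau> b}) g"
    using x b by (simp add: continuous_on_eq_continuous_within)
  moreover have "at x within {0..\<tau> b} = at x within {0..}"
    by (rule at_within_nhd[where S = "{..<\<tau> b}"]) (use b in auto)
  ultimately show "continuous (at x within {0..}) g" by simp
qed

lemma deriv_g:
  assumes x: "x > 0"
  shows "(g has_real_derivative inverse (u (g x))) (at x)"
proof (rule DERIV_inverse_function[where a = 0 and b = "x + 1"])
  show "(\<tau> has_real_derivative u (g x)) (at (g x))"
    using has_real_derivative_half_line_at[OF deriv_tau] g_pos[OF x] by simp
  show "u (g x) \<noteq> 0" using u_pos[OF g_pos[OF x]] by simp
  have "continuous_on {0<..} g" using cont_g by (rule continuous_on_subset) auto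
  then show "isCont g x" using x by (simp add: continuous_on_eq_continuous_at)
qed (use x tau_g in auto)

lemma in_new_time_eq: "in_new_time c j x = c j (g x)"
  by (simp add: in_new_time_def g_def \<tau>_def)

end

section \<open>The self-similar profile\<close>

text \<open>Only one term of the cofactor of \<open>a - b\<close> in \<open>a ^ n - b ^ n\<close> is
  kept. The power stays on the left because \<open>b\<close> will be \<open>K * \<rho> * w\<close>,
  which vanishes at \<open>w = 0\<close>.\<close>

lemma abs_diff_mult_power_le:
  fixes a b :: real
  assumes "a \<ge> 0" "b \<ge> 0" "n \<ge> 1"
  shows "\<bar>a - b\<bar> * b ^ (n - 1) \<le> \<bar>a ^ n - b ^ n\<bar>"
proof -
  have "b ^ (n - Suc 0) * a ^ 0 \<le> (\<Sum>i<n. b ^ (n - Suc i) * a ^ i)"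
    using assms by (intro member_le_sum[where i = 0 and f = "\<lambda>i. b ^ (n - Suc i) * a ^ i"]) auto
  then have "\<bar>a - b\<bar> * b ^ (n - 1) \<le> \<bar>a - b\<bar> * (\<Sum>i<n. b ^ (n - Suc i) * a ^ i)"
    by (intro mult_left_mono) auto
  also have "\<dots> = \<bar>(a - b) * (\<Sum>i<n. b ^ (n - Suc i) * a ^ i)\<bar>"
    using assms by (simp add: abs_mult sum_nonneg)
  also have "\<dots> = \<bar>a ^ n - b ^ n\<bar>" by (simp only: power_diff_sumr2)
  finally show ?thesis .
qed

text \<open>Since \<open>gamma_pdf (Suc p) s = gamma_pdf p s * s / N\<close> with
  \<open>N = Suc p\<close>, the relative difference is \<open>(N - s) / N\<close>. The numerator
  \<open>r * (\<xi> + y) - a\<close> is of order \<open>r * (1 + y)\<close> and the denominator at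
  least \<open>r^2 / 2\<close>: hence the extra \<open>1 / r\<close> and the weight
  \<open>1 + y\<close>.\<close>

lemma gamma_pdf_step_bound:
  fixes \<xi> a r y C :: real
  assumes r: "r \<ge> 1" "r \<ge> 2 * (\<bar>\<xi>\<bar> + a)" and m: "real (Suc p) = r\<^sup>2 + \<xi> * r - a" and a: "a \<ge> 0"
    and y: "0 \<le> y" "y \<le> r" and C: "C \<ge> 0"
    and gauss: "\<bar>sqrt (2 * pi) * r * gamma_pdf p (r\<^sup>2 - r * y) - exp (- (\<xi> + y)\<^sup>2 / 2)\<bar>
       \<le> C / r * (1 + y ^ 3) * exp (- (\<xi> + y)\<^sup>2 / 2)"
  shows "\<bar>gamma_pdf p (r\<^sup>2 - r * y) - gamma_pdf (Suc p) (r\<^sup>2 - r * y)\<bar>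
       \<le> 2 * (1 + C) * (\<bar>\<xi>\<bar> + a + 1) / (sqrt (2 * pi) * r * r) * ((1 + y ^ 3) * (1 + y) * exp (- (\<xi> + y)\<^sup>2 / 2))"
proof -
  define s where "s = r\<^sup>2 - r * y"
  define \<phi> where "\<phi> = exp (- (\<xi> + y)\<^sup>2 / 2)"
  define N where "N = real (Suc p)"
  have N0: "N > 0" by (simp add: N_def)
  have s: "s \<ge> 0" using y r by (simp add: s_def power2_eq_square mult_left_mono)
  have "gamma_pdf (Suc p) s = gamma_pdf p s * s / N"
    by (simp add: gamma_pdf_def N_def mult_ac)
  then have "gamma_pdf p s - gamma_pdf (Suc p) s = gamma_pdf p s * ((N - s) / N)"
    using N0 by (simp add: field_simps)
  then have 1: "\<bar>gamma_pdf p s - gamma_pdf (Suc p) s\<bar> = gamma_pdf p s * (\<bar>N - s\<bar> / N)"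
    using N0 gamma_pdf_nonneg[OF s] by (simp add: abs_mult)
  have half: "r\<^sup>2 / 2 \<le> N"
  proof -
    have "2 * (r * (\<bar>\<xi>\<bar> + a)) \<le> r * r" using mult_left_mono[OF r(2), of r] r by simp
    moreover have "- \<xi> * r \<le> \<bar>\<xi>\<bar> * r" using r by (intro mult_right_mono) auto
    moreover have "1 * a \<le> r * a" using r a by (intro mult_right_mono) auto
    ultimately show ?thesis unfolding N_def m power2_eq_square by (simp add: algebra_simps)
  qed
  have "\<bar>N - s\<bar> = \<bar>r * (\<xi> + y) - a\<bar>" unfolding N_def m s_def by (simp add: algebra_simps)
  also have "\<dots> \<le> r * \<bar>\<xi> + y\<bar> + a" using a r abs_triangle_ineq4[of "r * (\<xi> + y)" a] by (simp add: abs_mult)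
  also have "\<dots> \<le> r * (\<bar>\<xi>\<bar> + y) + r * a"
    using a r y mult_right_mono[of 1 r a] by (intro add_mono mult_left_mono) auto
  also have "\<dots> \<le> r * ((\<bar>\<xi>\<bar> + a + 1) * (1 + y))"
  proof -
    have "0 \<le> (\<bar>\<xi>\<bar> + a) * y" using a y by simp
    then have "(\<bar>\<xi>\<bar> + y) + a \<le> (\<bar>\<xi>\<bar> + a + 1) * (1 + y)" by (simp add: algebra_simps)
    from mult_left_mono[OF this, of r] show ?thesis using r by (simp add: algebra_simps)
  qed
  finally have "\<bar>N - s\<bar> / N \<le> r * ((\<bar>\<xi>\<bar> + a + 1) * (1 + y)) / (r\<^sup>2 / 2)"
    using half r a y by (intro frac_le) auto
  also have "\<dots> = 2 * (\<bar>\<xi>\<bar> + a + 1) * (1 + y) / r" using r by (simp add: power2_eq_square field_simps)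
  finally have 2: "\<bar>N - s\<bar> / N \<le> 2 * (\<bar>\<xi>\<bar> + a + 1) * (1 + y) / r" .
  have "sqrt (2 * pi) * r * gamma_pdf p s \<le> \<phi> + C / r * (1 + y ^ 3) * \<phi>"
    using gauss unfolding s_def \<phi>_def by linarith
  also have "\<dots> \<le> 1 * (1 + y ^ 3) * \<phi> + C * (1 + y ^ 3) * \<phi>"
  proof (intro add_mono mult_right_mono)
    show "\<phi> \<le> 1 * (1 + y ^ 3) * \<phi>" using y by (simp add: \<phi>_def mult_le_cancel_right1)
    have "C * 1 \<le> C * r" using C r by (intro mult_left_mono)
    then show "C / r \<le> C" using r by (simp add: field_simps)
  qed (use y in \<open>auto simp: \<phi>_def\<close>)
  finally have "sqrt (2 * pi) * r * gamma_pdf p s \<le> (1 + C) * (1 + y ^ 3) * \<phi>" by (simp add: algebra_simps)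
  then have 3: "gamma_pdf p s \<le> (1 + C) * (1 + y ^ 3) * \<phi> / (sqrt (2 * pi) * r)"
    using r by (simp add: pos_le_divide_eq mult.commute)
  have "gamma_pdf p s * (\<bar>N - s\<bar> / N) \<le>
     (1 + C) * (1 + y ^ 3) * \<phi> / (sqrt (2 * pi) * r) * (2 * (\<bar>\<xi>\<bar> + a + 1) * (1 + y) / r)"
    using 2 3 N0 gamma_pdf_nonneg[OF s] C y r by (intro mult_mono) (auto simp: \<phi>_def)
  also have "\<dots> = 2 * (1 + C) * (\<bar>\<xi>\<bar> + a + 1) / (sqrt (2 * pi) * r * r) * ((1 + y ^ 3) * (1 + y) * \<phi>)"
    by (simp only: mult_ac divide_inverse inverse_mult_distrib)
  finally show ?thesis unfolding 1[symmetric] unfolding s_def \<phi>_def .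
qed

lemma Phi2_has_integral:
  assumes n: "n \<ge> 1"
  shows "((\<lambda>w. exp (- (\<xi> + w ^ n)\<^sup>2 / 2)) has_integral Phi2 n \<xi>) {0..}"
proof -
  have "exp (- (\<xi> + w ^ n)\<^sup>2 / 2) = exp (- \<xi>\<^sup>2 / 2) * exp (- \<xi> * w ^ n - w ^ (2 * n) / 2)" for w
  proof -
    have "w ^ (2 * n) = (w ^ n)\<^sup>2" by (simp add: power_mult mult.commute)
    then have "- (\<xi> + w ^ n)\<^sup>2 / 2 = - \<xi>\<^sup>2 / 2 + (- \<xi> * w ^ n - w ^ (2 * n) / 2)"
      by (simp add: power2_eq_square field_simps)
    then show ?thesis by (simp only: exp_add)
  qed
  then have "Phi2 n \<xi> = integral {0..} (\<lambda>w. exp (- (\<xi> + w ^ n)\<^sup>2 / 2))"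
    unfolding Phi2_def by (simp only: integral_mult_right)
  then show ?thesis using polynomial_gauss_integrable(2)[OF n] by (simp add: has_integral_integral)
qed

context deposition
begin

lemma new_time_chain:
  "gamma_chain (\<lambda>x. S (g x)) (\<lambda>x. u (g x) ^ (n - 1)) (\<lambda>k x. c (n + k) (g x))"
proof
  have sub: "g ` {0..} \<subseteq> {0..}" using g_nonneg by auto
  show "continuous_on {0..} (\<lambda>x. S (g x))" by (rule continuous_on_compose2[where g = S and f = g, OF cont_S cont_g sub])
  show "continuous_on {0..} (\<lambda>x. c (n + k) (g x))" for k
    by (rule continuous_on_compose2[where g = "c (n + k)" and f = g, OF cont_c cont_g sub])
  show "S (g 0) = 0" by (simp add: g_0 S_0)
  show "c (n + k) (g 0) = 0" for k by (simp add: g_0 init)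
  fix x :: real assume x: "x > 0"
  note gx = g_pos[OF x] and dg = deriv_g[OF x]
  have ux: "u (g x) > 0" by (rule u_pos[OF gx])
  have un: "u (g x) ^ n * inverse (u (g x)) = u (g x) ^ (n - 1)" using ux n2 by (cases n) auto
  have chain: "((\<lambda>x. f (g x)) has_real_derivative D) (at x)"
    if "\<And>t. t \<ge> 0 \<Longrightarrow> (f has_real_derivative f' t) (at t within {0..})" "f' (g x) * inverse (u (g x)) = D" for f f' D
    using DERIV_chain2[where f = f and g = g, OF has_real_derivative_half_line_at[OF that(1) gx] dg] that(2) gx by simp
  show "((\<lambda>x. S (g x)) has_real_derivative u (g x) ^ (n - 1)) (at x)"
    by (rule chain[OF deriv_S un])
  show "((\<lambda>x. c (n + 0) (g x)) has_real_derivative u (g x) ^ (n - 1) - c (n + 0) (g x)) (at x)"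
  proof -
    have "u (g x) * c n (g x) * inverse (u (g x)) = c n (g x)" using ux by (simp add: field_simps)
    then show ?thesis using chain[OF deriv_c0 refl] by (simp only: left_diff_distrib un add_0_right)
  qed
  show "((\<lambda>x. c (n + Suc k) (g x)) has_real_derivative c (n + k) (g x) - c (n + Suc k) (g x)) (at x)" for k
  proof (rule chain)
    show "(c (n + Suc k) has_real_derivative u t * c (n + k) t - u t * c (n + Suc k) t) (at t within {0..})" if "t \<ge> 0" for t
      using deriv_c[OF that, of "n + Suc k"] by simp
    show "(u (g x) * c (n + k) (g x) - u (g x) * c (n + Suc k) (g x)) * inverse (u (g x)) = c (n + k) (g x) - c (n + Suc k) (g x)"
      using ux by (simp add: field_simps)
  qed
qed

text \<open>The constant in the growth law of \<open>S\<close>, written so that the prefactor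
  \<open>(\<alpha> / n) powr (1 / n) / \<alpha>\<close> of the theorem is
  \<open>1 / K\<close>.\<close>

definition K :: real where "K = \<alpha> / (\<alpha> / real n) powr (1 / real n)"

lemma K_pos: "K > 0"
  using alpha n2 by (simp add: K_def)

lemma K_power: "K ^ n = real n * \<alpha> ^ (n - 1)"
proof -
  have "((\<alpha> / real n) powr (1 / real n)) ^ n = \<alpha> / real n"
    using alpha n2 by (simp add: powr_powr flip: powr_realpow)
  moreover have "\<alpha> ^ n = \<alpha> * \<alpha> ^ (n - 1)" using n2 by (cases n) auto
  ultimately show ?thesis using alpha n2 by (simp add: K_def power_divide)
qed

lemma S_g_error:
  "\<exists>C\<ge>0. \<forall>\<rho> w. \<rho> > 0 \<longrightarrow> w \<ge> 0 \<longrightarrow>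
     \<bar>S (g ((\<rho> * w) ^ n)) - K * \<rho> * w\<bar> * (K * \<rho> * w) ^ (n - 1) \<le> C * (1 + ln (1 + (\<rho> * w) ^ n))"
proof -
  obtain C where C: "C \<ge> 0" "\<And>t. t \<ge> 0 \<Longrightarrow> \<bar>S t ^ n - real n * \<alpha> ^ (n - 1) * \<tau> t\<bar> \<le> C * (1 + ln (1 + \<tau> t))"
    using S_power_asymptotics by blast
  have "\<bar>S (g ((\<rho> * w) ^ n)) - K * \<rho> * w\<bar> * (K * \<rho> * w) ^ (n - 1) \<le> C * (1 + ln (1 + (\<rho> * w) ^ n))"
    if "\<rho> > 0" "w \<ge> 0" for \<rho> w
  proof -
    have x: "(\<rho> * w) ^ n \<ge> 0" using that by simp
    have "\<bar>S (g ((\<rho> * w) ^ n)) - K * \<rho> * w\<bar> * (K * \<rho> * w) ^ (n - 1)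
       \<le> \<bar>S (g ((\<rho> * w) ^ n)) ^ n - (K * \<rho> * w) ^ n\<bar>"
      using S_nonneg g_nonneg x K_pos that n2 by (intro abs_diff_mult_power_le) auto
    also have "(K * \<rho> * w) ^ n = real n * \<alpha> ^ (n - 1) * \<tau> (g ((\<rho> * w) ^ n))"
      unfolding tau_g[OF x] K_power[symmetric] by (simp add: power_mult_distrib)
    also have "\<bar>S (g ((\<rho> * w) ^ n)) ^ n - real n * \<alpha> ^ (n - 1) * \<tau> (g ((\<rho> * w) ^ n))\<bar> \<le> C * (1 + ln (1 + (\<rho> * w) ^ n))"
      using C(2)[OF g_nonneg[OF x]] tau_g[OF x] by simp
    finally show ?thesis .
  qed
  then show ?thesis using C(1) by blast
qed

text \<open>The integrands are compared pointwise with the weight \<open>G\<close>, the first one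
  extended by 0 beyond \<rho>, so that a single integral of \<open>G\<close> bounds everything. The
  scale of the main term is factored out and leaves the relative error.\<close>

lemma in_new_time_approx:
  "\<exists>C R. R \<ge> 1 \<and> (\<forall>\<rho> p. \<rho> > 0 \<longrightarrow> \<rho> ^ n \<ge> R \<longrightarrow> real (Suc p) = (\<rho> ^ n)\<^sup>2 + \<xi> * \<rho> ^ n - real n \<longrightarrow>
     \<bar>c (n + Suc p) (g (\<rho> ^ (2 * n))) - K * \<rho> / (sqrt (2 * pi) * \<rho> ^ n) * Phi2 n \<xi>\<bar>
       \<le> K * \<rho> / (sqrt (2 * pi) * \<rho> ^ n) * (C * (1 + ln (1 + (\<rho> ^ n)\<^sup>2)) / \<rho> ^ n))"
proof -
  have n1: "n \<ge> 1" using n2 by simp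
  obtain C1 R1 where C1: "C1 \<ge> 0" "R1 \<ge> 1" "\<And>r m y. r \<ge> R1 \<Longrightarrow> real m = r\<^sup>2 + \<xi> * r - real n \<Longrightarrow> 0 \<le> y \<Longrightarrow> y \<le> r \<Longrightarrow>
           \<bar>sqrt (2 * pi) * r * gamma_pdf m (r\<^sup>2 - r * y) - exp (- (\<xi> + y)\<^sup>2 / 2)\<bar>
             \<le> C1 / r * (1 + y ^ 3) * exp (- (\<xi> + y)\<^sup>2 / 2)"
    using gamma_pdf_gauss[of "real n" \<xi>] by auto
  \<comment> \<open>The index \<open>p\<close> is one less than \<open>Suc p\<close>, hence the
    shift \<open>n + 1\<close>; it enters through the difference of the densities.\<close>
  obtain C2 R2 where C2: "C2 \<ge> 0" "R2 \<ge> 1" "\<And>r m y. r \<ge> R2 \<Longrightarrow> real m = r\<^sup>2 + \<xi> * r - (real n + 1) \<Longrightarrow> 0 \<le> y \<Longrightarrow> y \<le> r \<Longrightarrow>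
           \<bar>sqrt (2 * pi) * r * gamma_pdf m (r\<^sup>2 - r * y) - exp (- (\<xi> + y)\<^sup>2 / 2)\<bar>
             \<le> C2 / r * (1 + y ^ 3) * exp (- (\<xi> + y)\<^sup>2 / 2)"
    using gamma_pdf_gauss[of "real n + 1" \<xi>] by auto
  obtain CE where CE: "CE \<ge> 0" "\<And>\<rho> w. \<rho> > 0 \<Longrightarrow> w \<ge> 0 \<Longrightarrow>
     \<bar>S (g ((\<rho> * w) ^ n)) - K * \<rho> * w\<bar> * (K * \<rho> * w) ^ (n - 1) \<le> CE * (1 + ln (1 + (\<rho> * w) ^ n))"
    using S_g_error by blast
  define \<phi> where "\<phi> = (\<lambda>y. exp (- (\<xi> + y)\<^sup>2 / 2))"
  define G where "G = (\<lambda>y. (1 + y ^ 3) * (1 + y) * \<phi> y)"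
  define IG where "IG = integral {0..} (\<lambda>w. G (w ^ n))"
  have G_int: "(\<lambda>w. G (w ^ n)) integrable_on {0..}"
    using polynomial_gauss_integrable(1)[OF n1] unfolding G_def \<phi>_def .
  define D where "D = 2 * (1 + C2) * (\<bar>\<xi>\<bar> + real n + 1)"
  \<comment> \<open>The summands serve the Gaussian approximation, the error of \<open>S\<close>,
    and the tail beyond \<rho>, where \<open>C3 * Lg \<ge> 1\<close> is what counts.\<close>
  define C3 where "C3 = C1 + real n * CE * D / K ^ n + 1"
  define R where "R = max (max R1 R2) (2 * (\<bar>\<xi>\<bar> + real n))"
  have D0: "D \<ge> 0" unfolding D_def using C2(1) by simp
  have q0: "0 \<le> real n * CE * D / K ^ n" using CE(1) D0 K_pos by simp
  have "\<bar>c (n + Suc p) (g (\<rho> ^ (2 * n))) - K * \<rho> / (sqrt (2 * pi) * \<rho> ^ n) * Phi2 n \<xi>\<bar>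
       \<le> K * \<rho> / (sqrt (2 * pi) * \<rho> ^ n) * ((C3 * IG) * (1 + ln (1 + (\<rho> ^ n)\<^sup>2)) / \<rho> ^ n)"
    if rho: "\<rho> > 0" "\<rho> ^ n \<ge> R" and m: "real (Suc p) = (\<rho> ^ n)\<^sup>2 + \<xi> * \<rho> ^ n - real n" for \<rho> p
  proof -
    define r where "r = \<rho> ^ n"
    define A where "A = K * \<rho> / (sqrt (2 * pi) * r)"
    define Lg where "Lg = 1 + ln (1 + r\<^sup>2)"
    have r: "r \<ge> R1" "r \<ge> R2" "r \<ge> 1" "r \<ge> 2 * (\<bar>\<xi>\<bar> + real n)" "r > 0"
      using rho(2) C1(2) unfolding R_def r_def by auto
    have A0: "A > 0" using K_pos rho r by (simp add: A_def)
    have Lg: "Lg \<ge> 1" by (simp add: Lg_def)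
    have X: "\<rho> ^ (2 * n) = r\<^sup>2" by (simp add: r_def power_mult mult.commute)
    have xw: "(\<rho> * w) ^ n = r * w ^ n" for w by (simp add: r_def power_mult_distrib)
    have m': "real (Suc p) = r\<^sup>2 + \<xi> * r - real n" "real p = r\<^sup>2 + \<xi> * r - (real n + 1)"
      using m by (simp_all add: r_def)
    define F where "F = (\<lambda>w. K * \<rho> * gamma_pdf (Suc p) (r\<^sup>2 - r * w ^ n) +
            real n * \<rho> * (\<rho> * w) ^ (n - 1) * (S (g ((\<rho> * w) ^ n)) - K * \<rho> * w) *
              (gamma_pdf p (r\<^sup>2 - r * w ^ n) - gamma_pdf (Suc p) (r\<^sup>2 - r * w ^ n)))"
    have F_int: "(F has_integral c (n + Suc p) (g (\<rho> ^ (2 * n)))) {0..\<rho>}"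
      using gamma_chain.has_integral_representation[OF new_time_chain n1 rho(1), of K p]
      unfolding F_def X xw .
    have inner: "\<bar>F w - A * \<phi> (w ^ n)\<bar> \<le> A * (C3 * Lg / r) * G (w ^ n)" if w: "0 \<le> w" "w \<le> \<rho>" for w
    proof -
      define y where "y = w ^ n"
      have y: "0 \<le> y" "y \<le> r" using w by (auto simp: y_def r_def intro: power_mono)
      have phi0: "\<phi> y > 0" by (simp add: \<phi>_def)
      have G0: "G y \<ge> 0" using y phi0 by (simp add: G_def)
      have G1: "(1 + y ^ 3) * \<phi> y \<le> G y"
      proof -
        have "(1 + y ^ 3) * \<phi> y * 1 \<le> (1 + y ^ 3) * \<phi> y * (1 + y)"
          using y phi0 by (intro mult_left_mono) auto
        then show ?thesis by (simp add: G_def mult_ac)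
      qed
      have e1: "\<bar>K * \<rho> * gamma_pdf (Suc p) (r\<^sup>2 - r * y) - A * \<phi> y\<bar> \<le> A * (C1 * Lg / r) * G y"
      proof -
        have "K * \<rho> * gamma_pdf (Suc p) (r\<^sup>2 - r * y) = A * (sqrt (2 * pi) * r * gamma_pdf (Suc p) (r\<^sup>2 - r * y))"
          using r by (simp add: A_def)
        then have "\<bar>K * \<rho> * gamma_pdf (Suc p) (r\<^sup>2 - r * y) - A * \<phi> y\<bar>
           = A * \<bar>sqrt (2 * pi) * r * gamma_pdf (Suc p) (r\<^sup>2 - r * y) - \<phi> y\<bar>"
          using A0 by (simp only: right_diff_distrib[symmetric] abs_mult abs_of_pos)
        also have "\<dots> \<le> A * (C1 / r * ((1 + y ^ 3) * \<phi> y))"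
          using C1(3)[OF r(1) m'(1) y] A0 unfolding \<phi>_def by (intro mult_left_mono) (auto simp: mult.assoc)
        also have "\<dots> \<le> A * (C1 * Lg / r * G y)"
        proof (intro mult_left_mono mult_mono)
          have "C1 * 1 \<le> C1 * Lg" using C1(1) Lg by (intro mult_left_mono)
          then show "C1 / r \<le> C1 * Lg / r" using r by (intro divide_right_mono) auto
        qed (use G1 C1(1) Lg r y phi0 A0 in auto)
        finally show ?thesis by (simp only: mult.assoc)
      qed
      \<comment> \<open>This term carries the logarithm. The power
        \<open>(\<rho> * w) ^ (n - 1)\<close> is attached to \<open>E\<close> before estimating,
        since \<open>E\<close> alone has no uniform bound of the right order near 0 from
        \<open>CE\<close>.\<close>
      have e2: "\<bar>real n * \<rho> * (\<rho> * w) ^ (n - 1) * (S (g ((\<rho> * w) ^ n)) - K * \<rho> * w) *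
              (gamma_pdf p (r\<^sup>2 - r * y) - gamma_pdf (Suc p) (r\<^sup>2 - r * y))\<bar>
            \<le> A * (real n * CE * D / K ^ n * Lg / r) * G y"
      proof -
        define E where "E = S (g ((\<rho> * w) ^ n)) - K * \<rho> * w"
        have "\<bar>E\<bar> * (K * \<rho> * w) ^ (n - 1) \<le> CE * (1 + ln (1 + r * y))"
          using CE(2)[OF rho(1) w(1)] unfolding E_def xw y_def .
        also have "\<dots> \<le> CE * Lg"
        proof -
          have "r * y \<le> r\<^sup>2" using y r by (simp add: power2_eq_square mult_left_mono)
          moreover have "0 \<le> r * y" using y r by simp
          ultimately have "ln (1 + r * y) \<le> ln (1 + r\<^sup>2)" by simp
          then show ?thesis using CE(1) unfolding Lg_def by (intro mult_left_mono) auto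
        qed
        finally have "K ^ (n - 1) * (\<bar>E\<bar> * (\<rho> * w) ^ (n - 1)) \<le> CE * Lg"
          by (simp add: mult.assoc power_mult_distrib mult_ac)
        then have E1: "\<bar>E\<bar> * (\<rho> * w) ^ (n - 1) \<le> CE * Lg / K ^ (n - 1)"
          using K_pos by (simp add: pos_le_divide_eq mult.commute)
        have d: "\<bar>gamma_pdf p (r\<^sup>2 - r * y) - gamma_pdf (Suc p) (r\<^sup>2 - r * y)\<bar> \<le> D / (sqrt (2 * pi) * r * r) * G y"
          using gamma_pdf_step_bound[OF r(3,4) m'(1) _ y C2(1) C2(3)[OF r(2) m'(2) y]]
          unfolding D_def G_def \<phi>_def by simp
        have "\<bar>real n * \<rho> * (\<rho> * w) ^ (n - 1) * E * (gamma_pdf p (r\<^sup>2 - r * y) - gamma_pdf (Suc p) (r\<^sup>2 - r * y))\<bar>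
          = real n * \<rho> * (\<bar>E\<bar> * (\<rho> * w) ^ (n - 1)) * \<bar>gamma_pdf p (r\<^sup>2 - r * y) - gamma_pdf (Suc p) (r\<^sup>2 - r * y)\<bar>"
          using rho w by (simp add: abs_mult)
        also have "\<dots> \<le> real n * \<rho> * (CE * Lg / K ^ (n - 1)) * (D / (sqrt (2 * pi) * r * r) * G y)"
          using E1 d rho w CE(1) Lg K_pos by (intro mult_mono mult_left_mono) auto
        also have "\<dots> = A * (real n * CE * D / K ^ n * Lg / r) * G y"
        proof -
          have "K ^ n = K * K ^ (n - 1)" using n1 by (cases n) auto
          then show ?thesis using K_pos r unfolding A_def by (simp add: field_simps)
        qed
        finally show ?thesis unfolding E_def .
      qed
      have "\<bar>F w - A * \<phi> (w ^ n)\<bar> \<le> A * (C1 * Lg / r) * G y + A * (real n * CE * D / K ^ n * Lg / r) * G y"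
        using e1 e2 unfolding F_def y_def[symmetric] by linarith
      also have "\<dots> = A * ((C1 + real n * CE * D / K ^ n) * Lg / r) * G y"
        by (simp add: add_divide_distrib distrib_left distrib_right)
      also have "\<dots> \<le> A * (C3 * Lg / r) * G y"
        using A0 Lg r G0 unfolding C3_def by (intro mult_right_mono mult_left_mono divide_right_mono) auto
      finally show ?thesis unfolding y_def .
    qed
    \<comment> \<open>Nothing cancels beyond \<rho>, but there \<open>y \<ge> r\<close>, so
      \<open>G y \<ge> r * \<phi> y\<close>, and this factor \<open>r\<close> makes up for the
      \<open>1 / r\<close> in the bound.\<close>
    have outer: "\<bar>A * \<phi> (w ^ n)\<bar> \<le> A * (C3 * Lg / r) * G (w ^ n)" if w: "w > \<rho>" for w
    proof -
      define y where "y = w ^ n"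
      have y: "y \<ge> r" unfolding y_def r_def using w rho by (intro power_mono) auto
      have phi0: "\<phi> y > 0" by (simp add: \<phi>_def)
      have 1: "1 * 1 \<le> C3 * Lg" unfolding C3_def using C1(1) q0 Lg by (intro mult_mono) auto
      have "r \<le> 1 * (1 + y)" using y by simp
      also have "\<dots> \<le> (1 + y ^ 3) * (1 + y)" using y r by (intro mult_right_mono) auto
      finally have 2: "r \<le> (1 + y ^ 3) * (1 + y)" .
      have "1 * r \<le> C3 * Lg * ((1 + y ^ 3) * (1 + y))"
        by (rule mult_mono[OF _ 2]) (use 1 r in auto)
      then have "1 \<le> C3 * Lg / r * ((1 + y ^ 3) * (1 + y))" using r by (simp add: field_simps)
      then have "A * \<phi> y * 1 \<le> A * \<phi> y * (C3 * Lg / r * ((1 + y ^ 3) * (1 + y)))"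
        using A0 phi0 by (intro mult_left_mono) auto
      also have "\<dots> = A * (C3 * Lg / r) * G y" unfolding G_def by (simp only: mult_ac)
      finally show ?thesis using A0 phi0 unfolding y_def by simp
    qed
    define f where "f = (\<lambda>w. (if w \<in> {0..\<rho>} then F w else 0) - A * \<phi> (w ^ n))"
    have "((\<lambda>w. if w \<in> {0..\<rho>} then F w else 0) has_integral c (n + Suc p) (g (\<rho> ^ (2 * n)))) {0..}"
      using F_int by (subst has_integral_restrict) auto
    moreover have "((\<lambda>w. A * \<phi> (w ^ n)) has_integral A * Phi2 n \<xi>) {0..}"
      using Phi2_has_integral[OF n1] unfolding \<phi>_def by (rule has_integral_mult_right)
    ultimately have f_int: "(f has_integral c (n + Suc p) (g (\<rho> ^ (2 * n))) - A * Phi2 n \<xi>) {0..}"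
      unfolding f_def by (rule has_integral_diff)
    have "norm (integral {0..} f) \<le> integral {0..} (\<lambda>w. A * (C3 * Lg / r) * G (w ^ n))"
    proof (rule integral_norm_bound_integral)
      show "f integrable_on {0..}" using f_int by (rule has_integral_integrable)
      show "(\<lambda>w. A * (C3 * Lg / r) * G (w ^ n)) integrable_on {0..}"
        using G_int by (rule integrable_on_mult_right)
      show "norm (f w) \<le> A * (C3 * Lg / r) * G (w ^ n)" if "w \<in> {0..}" for w
        using inner[of w] outer[of w] that unfolding f_def by (cases "w \<le> \<rho>") auto
    qed
    then have "\<bar>c (n + Suc p) (g (\<rho> ^ (2 * n))) - A * Phi2 n \<xi>\<bar> \<le> A * (C3 * Lg / r) * IG"
      using integral_unique[OF f_int] unfolding IG_def by simp
    also have "\<dots> = A * ((C3 * IG) * Lg / r)" by simp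
    finally show ?thesis unfolding A_def Lg_def r_def .
  qed
  moreover have "R \<ge> 1" using C1(2) unfolding R_def by simp
  ultimately show ?thesis by blast
qed

end

section \<open>From r back to j\<close>

lemma ln_over_root_bound:
  fixes \<xi> r :: real and j :: nat
  assumes r: "r \<ge> 1" "r \<ge> 2 * \<bar>\<xi>\<bar>" and j: "real j = r\<^sup>2 + \<xi> * r" "j \<ge> 4"
  shows "(1 + ln (1 + r\<^sup>2)) / r \<le> 4 * sqrt (1 + \<bar>\<xi>\<bar>) * (real j powr (- 1 / 2) * ln (real j))"
proof -
  have a: "r * \<bar>\<xi>\<bar> \<le> r\<^sup>2 / 2" using mult_left_mono[OF r(2), of r] r(1) by (simp add: power2_eq_square)
  have b: "\<bar>\<xi> * r\<bar> = r * \<bar>\<xi>\<bar>" using r by (simp add: abs_mult)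
  have j1: "r\<^sup>2 / 2 \<le> real j" using a b j(1) by linarith
  have "r * \<bar>\<xi>\<bar> \<le> r\<^sup>2 * \<bar>\<xi>\<bar>" using r by (intro mult_right_mono) (auto simp: power2_eq_square)
  then have "real j \<le> r\<^sup>2 + r\<^sup>2 * \<bar>\<xi>\<bar>" using b j(1) by linarith
  then have j2: "real j \<le> (1 + \<bar>\<xi>\<bar>) * r\<^sup>2" by (simp add: algebra_simps)
  have "sqrt (real j) \<le> sqrt (1 + \<bar>\<xi>\<bar>) * r"
    using real_sqrt_le_mono[OF j2] r by (simp add: real_sqrt_mult)
  then have "1 / r \<le> sqrt (1 + \<bar>\<xi>\<bar>) / sqrt (real j)" using r j by (simp add: field_simps)
  also have "1 / sqrt (real j) = real j powr (- 1 / 2)"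
    using j by (simp add: powr_minus_divide powr_half_sqrt)
  then have "sqrt (1 + \<bar>\<xi>\<bar>) / sqrt (real j) = sqrt (1 + \<bar>\<xi>\<bar>) * real j powr (- 1 / 2)"
    by (metis times_divide_eq_right mult.right_neutral)
  finally have 1: "1 / r \<le> sqrt (1 + \<bar>\<xi>\<bar>) * real j powr (- 1 / 2)" .
  \<comment> \<open>As \<open>r^2 \<le> 2 * j\<close>, the cube is ample. The resulting 3 and the
    summand 1, absorbed by \<open>ln j \<ge> 1\<close> for \<open>j \<ge> 4\<close>, make up the
    factor 4.\<close>
  have "1 + r\<^sup>2 \<le> real j ^ 3"
  proof -
    have "1 + r\<^sup>2 \<le> 4 * real j" using j1 j by simp
    also have "\<dots> \<le> real j ^ 2 * real j" using j power_mono[of 2 "real j" 2] by (intro mult_right_mono) auto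
    finally show ?thesis by (simp add: power3_eq_cube power2_eq_square)
  qed
  then have "ln (1 + r\<^sup>2) \<le> ln (real j ^ 3)" using j by (intro ln_mono) (auto simp: add_pos_nonneg)
  also have "\<dots> = 3 * ln (real j)" using j by (simp add: ln_realpow)
  finally have l: "ln (1 + r\<^sup>2) \<le> 3 * ln (real j)" .
  have "exp 1 \<le> real j" using exp_le j by linarith
  then have "1 \<le> ln (real j)" using j by (simp add: ln_ge_iff)
  then have "0 \<le> ln (real j)" "1 + ln (1 + r\<^sup>2) \<le> 4 * ln (real j)" "1 + ln (1 + r\<^sup>2) \<ge> 0" using l by (auto intro: add_nonneg_nonneg)
  then have "(1 + ln (1 + r\<^sup>2)) * (1 / r) \<le> 4 * ln (real j) * (sqrt (1 + \<bar>\<xi>\<bar>) * real j powr (- 1 / 2))"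
    using 1 r j by (intro mult_mono) auto
  then show ?thesis by (simp add: mult_ac)
qed

theorem theorem1p2:
  fixes n :: nat and \<alpha> :: real and c :: "nat \<Rightarrow> real \<Rightarrow> real"
  assumes "n \<ge> 2"
    and "\<alpha> > 0"
    and "deposition_solution n \<alpha> c"
    and "\<And>j. j \<ge> n \<Longrightarrow> c j 0 = 0"
  shows "\<forall>\<xi>::real. \<exists>C::real. \<exists>(J::nat) (T::real). \<forall>(j::nat) (\<tau>::real).
           j \<ge> J \<longrightarrow> \<tau> \<ge> T \<longrightarrow> (real j - \<tau>) / sqrt \<tau> = \<xi> \<longrightarrow>
           \<bar>sqrt (2 * pi) / \<alpha> * (\<alpha> / real n) powr (1 / real n)
               * \<tau> powr ((real n - 1) / (2 * real n)) * in_new_time c j \<tau> - Phi2 n \<xi>\<bar>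
             \<le> C * real j powr (- 1 / 2) * ln (real j)"
proof
  fix \<xi> :: real
  interpret deposition n \<alpha> c by unfold_locales (use assms in auto)
  obtain C R where R: "R \<ge> 1" and C: "\<And>\<rho> p. \<rho> > 0 \<Longrightarrow> \<rho> ^ n \<ge> R \<Longrightarrow> real (Suc p) = (\<rho> ^ n)\<^sup>2 + \<xi> * \<rho> ^ n - real n \<Longrightarrow>
     \<bar>c (n + Suc p) (g (\<rho> ^ (2 * n))) - K * \<rho> / (sqrt (2 * pi) * \<rho> ^ n) * Phi2 n \<xi>\<bar>
       \<le> K * \<rho> / (sqrt (2 * pi) * \<rho> ^ n) * (C * (1 + ln (1 + (\<rho> ^ n)\<^sup>2)) / \<rho> ^ n)"
    using in_new_time_approx[of \<xi>] by blast
  define C' where "C' = \<bar>C\<bar> * (4 * sqrt (1 + \<bar>\<xi>\<bar>))"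
  define r0 where "r0 = max R (2 * \<bar>\<xi>\<bar>)"
  \<comment> \<open>\<open>n + 4\<close> makes \<open>j - n - 1\<close> a genuine subtraction and
    gives \<open>ln j \<ge> 1\<close>; \<open>r0\<close> collects the thresholds on
    \<open>sqrt t\<close>.\<close>
  have "\<bar>sqrt (2 * pi) / \<alpha> * (\<alpha> / real n) powr (1 / real n)
               * t powr ((real n - 1) / (2 * real n)) * in_new_time c j t - Phi2 n \<xi>\<bar>
             \<le> C' * real j powr (- 1 / 2) * ln (real j)"
    if j: "j \<ge> n + 4" and t: "t \<ge> r0\<^sup>2" and eq: "(real j - t) / sqrt t = \<xi>" for j t
  proof -
    have r0: "r0 \<ge> 1" using R by (simp add: r0_def)
    define r where "r = sqrt t"
    have "sqrt (r0\<^sup>2) \<le> r" unfolding r_def using t by (rule real_sqrt_le_mono)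
    then have r: "r \<ge> r0" "r \<ge> 1" "r > 0" using r0 by auto
    have t_eq: "t = r\<^sup>2" using r by (simp add: r_def)
    have tpos: "t > 0" using r t_eq by simp
    have jr: "real j = r\<^sup>2 + \<xi> * r"
    proof -
      have "(real j - r\<^sup>2) / r = \<xi>" using eq unfolding r_def[symmetric] t_eq using r by simp
      then show ?thesis using r by (simp add: field_simps)
    qed
    define \<rho> where "\<rho> = r powr (1 / real n)"
    have rho: "\<rho> > 0" using r by (simp add: \<rho>_def)
    have rhon: "\<rho> ^ n = r" unfolding \<rho>_def using r assms(1) by (simp add: powr_powr flip: powr_realpow)
    have rho2n: "\<rho> ^ (2 * n) = t" using rhon by (simp add: t_eq power_mult mult.commute)
    define A where "A = K * \<rho> / (sqrt (2 * pi) * r)"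
    have A0: "A > 0" using K_pos rho r by (simp add: A_def)
    define p where "p = j - n - 1"
    have pj: "n + Suc p = j" using j by (simp add: p_def)
    have "real (Suc p) = r\<^sup>2 + \<xi> * r - real n" unfolding jr[symmetric] pj[symmetric] by simp
    then have main: "\<bar>c j (g t) - A * Phi2 n \<xi>\<bar> \<le> A * (C * (1 + ln (1 + r\<^sup>2)) / r)"
      using C[of \<rho> p] rho r unfolding rhon rho2n pj A_def r0_def by simp
    \<comment> \<open>The normalisation in the theorem is the reciprocal of the scale
      \<open>A\<close>, because \<open>t powr ((n - 1) / (2 * n)) = r / \<rho>\<close>; so the
      relative error is what is left to bound.\<close>
    have pre: "sqrt (2 * pi) / \<alpha> * (\<alpha> / real n) powr (1 / real n) * t powr ((real n - 1) / (2 * real n)) = 1 / A"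
    proof -
      have "t powr ((real n - 1) / (2 * real n)) = r powr (2 * ((real n - 1) / (2 * real n)))"
        unfolding t_eq using r by (simp add: powr_powr flip: powr_numeral)
      also have "2 * ((real n - 1) / (2 * real n)) = 1 - 1 / real n" using assms(1) by (simp add: field_simps)
      also have "r powr (1 - 1 / real n) = r / \<rho>" unfolding \<rho>_def using r by (simp add: powr_diff)
      finally have "t powr ((real n - 1) / (2 * real n)) = r / \<rho>" .
      moreover have "(\<alpha> / real n) powr (1 / real n) > 0" using assms(1,2) by simp
      ultimately show ?thesis using assms(2) rho r unfolding A_def K_def by (simp add: field_simps)
    qed
    have "\<bar>1 / A * c j (g t) - Phi2 n \<xi>\<bar> = \<bar>c j (g t) - A * Phi2 n \<xi>\<bar> / A"
      using A0 by (simp add: field_simps abs_mult abs_div)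
    also have "\<dots> \<le> C * (1 + ln (1 + r\<^sup>2)) / r" using main A0 by (simp add: pos_divide_le_eq mult.commute)
    also have "\<dots> \<le> \<bar>C\<bar> * ((1 + ln (1 + r\<^sup>2)) / r)"
    proof -
      have "0 \<le> (1 + ln (1 + r\<^sup>2)) / r" using r by (simp add: add_nonneg_nonneg)
      from mult_right_mono[OF _ this, of C "\<bar>C\<bar>"] show ?thesis by simp
    qed
    also have "\<dots> \<le> \<bar>C\<bar> * (4 * sqrt (1 + \<bar>\<xi>\<bar>) * (real j powr (- 1 / 2) * ln (real j)))"
      using r j by (intro mult_left_mono ln_over_root_bound jr) (auto simp: r0_def)
    also have "\<dots> = C' * real j powr (- 1 / 2) * ln (real j)" by (simp add: C'_def)
    finally show ?thesis unfolding pre in_new_time_eq .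
  qed
  then show "\<exists>C J T. \<forall>j \<tau>. j \<ge> J \<longrightarrow> \<tau> \<ge> T \<longrightarrow> (real j - \<tau>) / sqrt \<tau> = \<xi> \<longrightarrow>
           \<bar>sqrt (2 * pi) / \<alpha> * (\<alpha> / real n) powr (1 / real n)
               * \<tau> powr ((real n - 1) / (2 * real n)) * in_new_time c j \<tau> - Phi2 n \<xi>\<bar>
             \<le> C * real j powr (- 1 / 2) * ln (real j)"
    by blast
qed

end
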